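(* Let $F(L)\in\mathbb{H}^\infty_d\otimes\mathcal{L}(\mathcal{F},\mathcal{J})$ and $G(L)\in\mathbb{H}^\infty_d\otimes\mathcal{L}(\mathcal{G},\mathcal{J})$ be operator-valued left multipliers and let $H(L)=F(L)\wedge G(L)\in\mathbb{H}^\infty_d\otimes\mathcal{L}(\mathcal{H},\mathcal{J})$. Then there is a left inner multiplier $\Gamma(L):\mathbb{H}^2_d\otimes\mathcal{H}\to\mathbb{H}^2_d\otimes(\mathcal{F}\oplus\mathcal{G})$ with $\mathrm{Ran}(\Gamma(L))\subseteq\mathrm{Ker}((F\vee G)(L))$ such that $$\begin{pmatrix}H(L)\\-H(L)\end{pmatrix}=\begin{pmatrix}F(L)&0\\0&G(L)\end{pmatrix}\Gamma(L).$$
   Context: Let $d\in\mathbb{N}$. The NC Hardy space (full Fock space) $\mathbb{H}^2_d$ is the Hilbert space of formal power series in $d$ non-commuting variables $\mathfrak{z}_1,\dots,\mathfrak{z}_d$ with square-summable coefficients. $R_k$ is the isometry of right multiplication by $\mathfrak{z}_k$, $R=(R_1,\dots,R_d)$. For Hilbert spaces $\mathcal{F},\mathcal{J}$, $\mathbb{H}^\infty_d\otimes\mathcal{L}(\mathcal{F},\mathcal{J})$ is the space of operator-valued left multipliers: equivalently the bounded operators $F=F(L):\mathbb{H}^2_d\otimes\mathcal{F}\to\mathbb{H}^2_d\otimes\mathcal{J}$ with $F(L)(R_k\otimes I_{\mathcal{F}})=(R_k\otimes I_{\mathcal{J}})F(L)$ for all $k$. A left multiplier is (left) inner if it is an isometry.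 $\mathscr{M}^L(F)$ is the space $\mathrm{Ran}(F(L))$ with norm $\|F(L)x\|_F:=\|P_{\mathrm{Ker}(F(L))^\perp}x\|$. $\mathscr{M}^L(F)\wedge\mathscr{M}^L(G)$ is $\mathscr{M}^L(F)\cap\mathscr{M}^L(G)$ with norm $\|h\|^2=\|h\|_F^2+\|h\|_G^2$. $F\vee G:=(F,G)\in\mathbb{H}^\infty_d\otimes\mathcal{L}(\mathcal{F}\oplus\mathcal{G},\mathcal{J})$ (row). $F\wedge G:=H\in\mathbb{H}^\infty_d\otimes\mathcal{L}(\mathcal{H},\mathcal{J})$ is the left multiplier with $\mathscr{M}^L(H)=\mathscr{M}:=\mathscr{M}^L(F)\wedge\mathscr{M}^L(G)$ given by the de Branges–Beurling construction $H(L)=\mathrm{e}P_{\mathscr{M}}U$, where $\mathrm{e}:\mathscr{M}\hookrightarrow\mathbb{H}^2_d\otimes\mathcal{J}$ is the embedding, $\hat X$ on $\hat{\mathscr{M}}\supseteq\mathscr{M}$ is the minimal row isometric dilation of the row contraction $X=(R\otimes I_{\mathcal{J}})|_{\mathscr{M}}$, $P_{\mathscr{M}}:\hat{\mathscr{M}}\to\mathscr{M}$ is the orthogonal projection, and $U:\mathbb{H}^2_d\otimes\mathcal{H}\to\hat{\mathscr{M}}$ is a unitary intertwining $R\otimes I_{\mathcal{H}}$ with $\hat X$. (A row isometric dilation of $X$ is a tuple of isometries $\hat X_k$ with pairwise orthogonal ranges on a larger space satisfying $P_{\mathscr{M}}\hat X^\alpha|_{\mathscr{M}}=X^\alpha$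 for all words $\alpha$ in $\{1,\dots,d\}$; minimal means that $\hat{\mathscr{M}}$ is the closed span of the $\hat X^\alpha\mathscr{M}$.) *)

theory Defs
  imports "HOL-Analysis.Analysis"
begin

section \<open>Complex Hilbert spaces\<close>

text \<open>The inner product is conjugate-linear in its first argument.\<close>

class complex_hilbert = banach +
  fixes scaleC :: "complex \<Rightarrow> 'a \<Rightarrow> 'a" (infixr "*\<^sub>C" 75)
    and cinner :: "'a \<Rightarrow> 'a \<Rightarrow> complex"
  assumes scaleC_add_right: "c *\<^sub>C (x + y) = c *\<^sub>C x + c *\<^sub>C y"
    and scaleC_add_left: "(c + c') *\<^sub>C x = c *\<^sub>C x + c' *\<^sub>C x"
    and scaleC_scaleC: "c *\<^sub>C (c' *\<^sub>C x) = (c * c') *\<^sub>C x"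
    and scaleR_scaleC: "r *\<^sub>R x = complex_of_real r *\<^sub>C x"
    and cinner_commute: "cinner x y = cnj (cinner y x)"
    and cinner_add_right: "cinner x (y + z) = cinner x y + cinner x z"
    and cinner_scaleC_right: "cinner x (c *\<^sub>C y) = c * cinner x y"
    and cinner_self: "cinner x x = complex_of_real ((norm x)\<^sup>2)"

lemma scaleC_one: "1 *\<^sub>C x = (x::'a::complex_hilbert)"
  using scaleR_scaleC[of 1 x] by simp

lemma cinner_add_left: "cinner (x + y) (z::'a::complex_hilbert) = cinner x z + cinner y z"
  by (metis cinner_commute cinner_add_right complex_cnj_add)

lemma cinner_scaleC_left: "cinner (c *\<^sub>C x) (y::'a::complex_hilbert) = cnj c * cinner x y"
  by (metis cinner_commute cinner_scaleC_right complex_cnj_mult)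

interpretation complex_vector: vector_space "scaleC :: complex \<Rightarrow> 'a \<Rightarrow> 'a::complex_hilbert"
  by unfold_locales (simp_all add: scaleC_add_right scaleC_add_left scaleC_scaleC scaleC_one)

lemma norm_scaleC:
  fixes x :: "'a::complex_hilbert"
  shows "norm (c *\<^sub>C x) = cmod c * norm x"
proof -
  have "complex_of_real ((norm (c *\<^sub>C x))\<^sup>2) = cnj c * c * complex_of_real ((norm x)\<^sup>2)"
    by (metis cinner_self cinner_scaleC_left cinner_scaleC_right mult.assoc)
  also have "\<dots> = complex_of_real ((cmod c * norm x)\<^sup>2)"
    using complex_norm_square[of c] by (simp add: power_mult_distrib mult.commute)
  finally have "(norm (c *\<^sub>C x))\<^sup>2 = (cmod c * norm x)\<^sup>2"
    using of_real_eq_iff by blast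
  then show ?thesis
    by (simp add: power2_eq_iff_nonneg)
qed

lemma Re_cinner_bound:
  fixes x y :: "'a::complex_hilbert"
  shows "\<bar>Re (cinner x y)\<bar> \<le> norm x * norm y"
proof -
  have *: "Re (cinner u v) \<le> norm u * norm v" for u v :: 'a
  proof -
    have "complex_of_real ((norm (u + v))\<^sup>2) = cinner u u + cinner v v + (cinner u v + cnj (cinner u v))"
      by (simp add: cinner_self[symmetric] cinner_add_left cinner_add_right
          cinner_commute[of v u] del: of_real_power)
    then have "Re (complex_of_real ((norm (u + v))\<^sup>2))
        = Re (cinner u u + cinner v v + (cinner u v + cnj (cinner u v)))"
      by (rule arg_cong)
    then have "(norm (u + v))\<^sup>2 = (norm u)\<^sup>2 + (norm v)\<^sup>2 + 2 * Re (cinner u v)"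
      by (simp add: cinner_self del: of_real_power)
    moreover have "(norm (u + v))\<^sup>2 \<le> (norm u + norm v)\<^sup>2"
      by (intro power_mono norm_triangle_ineq) simp
    ultimately show ?thesis
      by (simp add: power2_sum)
  qed
  have "cinner (- x) y = - cinner x y"
    by (metis add_eq_0_iff2 cinner_add_left add.right_inverse add_cancel_right_left neg_eq_iff_add_eq_0)
  then show ?thesis
    using *[of x y] *[of "- x" y] by (simp add: abs_le_iff)
qed

lemma cmod_cinner_bound:
  fixes x y :: "'a::complex_hilbert"
  shows "cmod (cinner x y) \<le> (norm x)\<^sup>2 + (norm y)\<^sup>2"
proof -
  have "\<bar>Im (cinner x y)\<bar> = \<bar>Re (cinner x (\<i> *\<^sub>C y))\<bar>"
    by (simp add: cinner_scaleC_right)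
  also have "\<dots> \<le> norm x * norm y"
    using Re_cinner_bound[of x "\<i> *\<^sub>C y"] by (simp add: norm_scaleC)
  finally have "cmod (cinner x y) \<le> 2 * norm x * norm y"
    using Re_cinner_bound[of x y] cmod_le[of "cinner x y"] by linarith
  also have "\<dots> \<le> (norm x)\<^sup>2 + (norm y)\<^sup>2"
    by (rule sum_squares_bound)
  finally show ?thesis .
qed

instantiation complex :: complex_hilbert
begin

definition "c *\<^sub>C (x::complex) = c * x"
definition "cinner (x::complex) y = cnj x * y"

instance
proof
  fix x :: complex
  show "cinner x x = complex_of_real ((norm x)\<^sup>2)"
    unfolding cinner_complex_def using complex_norm_square[of x] by (simp add: mult.commute)
qed (simp_all add: scaleC_complex_def cinner_complex_def distrib_left distrib_right
      scaleR_conv_of_real)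

end

text \<open>The product type carries the norm of the Hilbert space direct sum.\<close>

instantiation prod :: (complex_hilbert, complex_hilbert) complex_hilbert
begin

definition "c *\<^sub>C x = (c *\<^sub>C fst x, c *\<^sub>C snd x)"
definition "cinner x y = cinner (fst x) (fst y) + cinner (snd x) (snd y)"

instance
proof
  fix x y z :: "'a \<times> 'b" and c c' :: complex and r :: real
  show "cinner x y = cnj (cinner y x)"
    by (simp add: cinner_prod_def cinner_commute[of "fst x"] cinner_commute[of "snd x"])
  show "cinner x x = complex_of_real ((norm x)\<^sup>2)"
    by (simp add: cinner_prod_def norm_prod_def cinner_self)
qed (simp_all add: scaleC_prod_def cinner_prod_def scaleC_add_right scaleC_add_left scaleC_scaleC
      scaleR_prod_def scaleR_scaleC cinner_add_right cinner_scaleC_right algebra_simps)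

end

section \<open>The vector-valued full Fock space\<close>

text \<open>
  The type \<open>('d, 'f) fock\<close> is the Hilbert space tensor product of the full Fock space over
  the letters \<^typ>\<open>'d\<close> with \<^typ>\<open>'f\<close>, realised as the formal power series in the
  non-commuting variables indexed by \<^typ>\<open>'d\<close>, with square-summable coefficients
  in \<^typ>\<open>'f\<close>; words are lists of letters.
\<close>

typedef (overloaded) ('d, 'f) fock =
  "{f :: 'd list \<Rightarrow> 'f::complex_hilbert. (\<lambda>w. (norm (f w))\<^sup>2) summable_on UNIV}"
  morphisms coeff Fock
  by (rule exI[of _ "\<lambda>_. 0"]) simp

setup_lifting type_definition_fock

lemma coeff_summable: "(\<lambda>w. (norm (coeff f w))\<^sup>2) summable_on UNIV"
  using coeff[of f] by simp

lemma fock_eqI: "(\<And>w. coeff f w = coeff g w) \<Longrightarrow> f = g"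
  by (simp add: coeff_inject[symmetric] fun_eq_iff)

lemma square_summable_bounded:
  fixes f :: "'d list \<Rightarrow> 'f::real_normed_vector"
  assumes "\<And>A. finite A \<Longrightarrow> L2_set (\<lambda>w. norm (f w)) A \<le> B"
  shows "(\<lambda>w. (norm (f w))\<^sup>2) summable_on UNIV"
    and "sqrt (\<Sum>\<^sub>\<infinity>w. (norm (f w))\<^sup>2) \<le> B"
proof -
  have B: "B \<ge> 0"
    using assms[of "{}"] by simp
  have *: "(\<Sum>w\<in>A. (norm (f w))\<^sup>2) \<le> B\<^sup>2" if "finite A" for A
    using assms[OF that] unfolding L2_set_def by (rule sqrt_le_D)
  show s: "(\<lambda>w. (norm (f w))\<^sup>2) summable_on UNIV"
    by (rule nonneg_bdd_above_summable_on) (auto intro!: bdd_aboveI[of _ "B\<^sup>2"] *)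
  have "(\<Sum>\<^sub>\<infinity>w. (norm (f w))\<^sup>2) \<le> B\<^sup>2"
    by (rule infsum_le_finite_sums[OF s]) (rule *)
  then show "sqrt (\<Sum>\<^sub>\<infinity>w. (norm (f w))\<^sup>2) \<le> B"
    by (simp add: B real_le_lsqrt)
qed

lemma L2_set_le_norm:
  fixes f :: "'d list \<Rightarrow> 'f::real_normed_vector"
  assumes "(\<lambda>w. (norm (f w))\<^sup>2) summable_on UNIV"
  shows "L2_set (\<lambda>w. norm (f w)) A \<le> sqrt (\<Sum>\<^sub>\<infinity>w. (norm (f w))\<^sup>2)"
proof (cases "finite A")
  case True
  then show ?thesis
    unfolding L2_set_def using finite_sum_le_infsum[OF assms True] by simp
next
  case False
  then show ?thesis by (simp add: infsum_nonneg)
qed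

lemma L2_set_add_le:
  fixes f g :: "'d list \<Rightarrow> 'f::real_normed_vector"
  assumes "(\<lambda>w. (norm (f w))\<^sup>2) summable_on UNIV" "(\<lambda>w. (norm (g w))\<^sup>2) summable_on UNIV"
  shows "L2_set (\<lambda>w. norm (f w + g w)) A
           \<le> sqrt (\<Sum>\<^sub>\<infinity>w. (norm (f w))\<^sup>2) + sqrt (\<Sum>\<^sub>\<infinity>w. (norm (g w))\<^sup>2)"
proof -
  have "L2_set (\<lambda>w. norm (f w + g w)) A \<le> L2_set (\<lambda>w. norm (f w) + norm (g w)) A"
    by (rule L2_set_mono) (auto intro: norm_triangle_ineq)
  also have "\<dots> \<le> L2_set (\<lambda>w. norm (f w)) A + L2_set (\<lambda>w. norm (g w)) A"
    by (rule L2_set_triangle_ineq)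
  also have "\<dots> \<le> sqrt (\<Sum>\<^sub>\<infinity>w. (norm (f w))\<^sup>2) + sqrt (\<Sum>\<^sub>\<infinity>w. (norm (g w))\<^sup>2)"
    by (intro add_mono L2_set_le_norm assms)
  finally show ?thesis .
qed

lemma square_summable_add:
  fixes f g :: "'d list \<Rightarrow> 'f::real_normed_vector"
  assumes "(\<lambda>w. (norm (f w))\<^sup>2) summable_on UNIV" "(\<lambda>w. (norm (g w))\<^sup>2) summable_on UNIV"
  shows "(\<lambda>w. (norm (f w + g w))\<^sup>2) summable_on UNIV"
  by (rule square_summable_bounded(1)) (rule L2_set_add_le[OF assms])

lemma square_summable_scaleC:
  fixes f :: "'d list \<Rightarrow> 'f::complex_hilbert"
  assumes "(\<lambda>w. (norm (f w))\<^sup>2) summable_on UNIV"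
  shows "(\<lambda>w. (norm (c *\<^sub>C f w))\<^sup>2) summable_on UNIV"
  using summable_on_cmult_right[OF assms, of "(cmod c)\<^sup>2"]
  by (simp add: norm_scaleC power_mult_distrib)

lemma square_summable_diff:
  fixes f g :: "'d list \<Rightarrow> 'f::real_normed_vector"
  assumes "(\<lambda>w. (norm (f w))\<^sup>2) summable_on UNIV" "(\<lambda>w. (norm (g w))\<^sup>2) summable_on UNIV"
  shows "(\<lambda>w. (norm (f w - g w))\<^sup>2) summable_on UNIV"
  using square_summable_add[of f "\<lambda>w. - g w"] assms by simp

lemma cinner_summable:
  fixes f g :: "'d list \<Rightarrow> 'f::complex_hilbert"
  assumes "(\<lambda>w. (norm (f w))\<^sup>2) summable_on UNIV" "(\<lambda>w. (norm (g w))\<^sup>2) summable_on UNIV"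
  shows "(\<lambda>w. cinner (f w) (g w)) summable_on UNIV"
  by (rule abs_summable_summable, rule Infinite_Sum.abs_summable_on_comparison_test'[OF summable_on_add[OF assms]])
    (rule cmod_cinner_bound)

instantiation fock :: (type, complex_hilbert) real_normed_vector
begin

lift_definition zero_fock :: "('a, 'b) fock" is "\<lambda>_. 0"
  by simp

lift_definition plus_fock :: "('a, 'b) fock \<Rightarrow> ('a, 'b) fock \<Rightarrow> ('a, 'b) fock"
  is "\<lambda>f g w. f w + g w"
  by (simp add: square_summable_add)

lift_definition uminus_fock :: "('a, 'b) fock \<Rightarrow> ('a, 'b) fock" is "\<lambda>f w. - f w"
  by simp

lift_definition minus_fock :: "('a, 'b) fock \<Rightarrow> ('a, 'b) fock \<Rightarrow> ('a, 'b) fock"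
  is "\<lambda>f g w. f w - g w"
  by (simp add: square_summable_diff)

lift_definition scaleR_fock :: "real \<Rightarrow> ('a, 'b) fock \<Rightarrow> ('a, 'b) fock"
  is "\<lambda>r f w. r *\<^sub>R f w"
  by (simp add: square_summable_scaleC scaleR_scaleC del: norm_scaleR)

definition norm_fock :: "('a, 'b) fock \<Rightarrow> real" where
  "norm_fock f = sqrt (\<Sum>\<^sub>\<infinity>w. (norm (coeff f w))\<^sup>2)"

definition dist_fock :: "('a, 'b) fock \<Rightarrow> ('a, 'b) fock \<Rightarrow> real" where
  "dist_fock f g = norm (f - g)"

definition sgn_fock :: "('a, 'b) fock \<Rightarrow> ('a, 'b) fock" where
  "sgn_fock f = scaleR (inverse (norm f)) f"

definition uniformity_fock :: "(('a, 'b) fock \<times> ('a, 'b) fock) filter" where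
  "uniformity_fock = (INF e\<in>{0 <..}. principal {(x, y). dist x y < e})"

definition open_fock :: "('a, 'b) fock set \<Rightarrow> bool" where
  "open_fock U \<longleftrightarrow> (\<forall>x\<in>U. eventually (\<lambda>(x', y). x' = x \<longrightarrow> y \<in> U) uniformity)"

lemmas coeff_simps = zero_fock.rep_eq plus_fock.rep_eq uminus_fock.rep_eq minus_fock.rep_eq scaleR_fock.rep_eq

lemma norm_coeff_le: "norm (coeff f w) \<le> norm f" for f :: "('a, 'b) fock"
  using L2_set_le_norm[OF coeff_summable[of f], of "{w}"] by (simp add: norm_fock_def)

instance
proof
  fix f g h :: "('a, 'b) fock" and r :: real
  show "dist f g = norm (f - g)"
    by (simp add: dist_fock_def)
  show "sgn f = scaleR (inverse (norm f)) f"
    by (simp add: sgn_fock_def)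
  show "(uniformity :: (('a, 'b) fock \<times> ('a, 'b) fock) filter)
      = (INF e\<in>{0 <..}. principal {(x, y). dist x y < e})"
    by (simp add: uniformity_fock_def)
  show "open U \<longleftrightarrow> (\<forall>x\<in>U. eventually (\<lambda>(x', y). x' = x \<longrightarrow> y \<in> U) uniformity)"
    for U :: "('a, 'b) fock set"
    by (simp add: open_fock_def)
  show "norm f = 0 \<longleftrightarrow> f = 0"
  proof
    assume "norm f = 0"
    then have "coeff f w = 0" for w
      using norm_coeff_le[of f w] by simp
    then show "f = 0"
      by (intro fock_eqI) (simp add: coeff_simps)
  qed (simp add: norm_fock_def coeff_simps)
  show "norm (f + g) \<le> norm f + norm g"
    unfolding norm_fock_def coeff_simps
    by (rule square_summable_bounded(2)) (rule L2_set_add_le[OF coeff_summable coeff_summable])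
  show "norm (r *\<^sub>R f) = \<bar>r\<bar> * norm f"
    by (simp add: norm_fock_def coeff_simps power_mult_distrib infsum_cmult_right' real_sqrt_mult)
qed (rule fock_eqI, simp add: coeff_simps algebra_simps)+

end

instance fock :: (type, complex_hilbert) banach
proof
  fix X :: "nat \<Rightarrow> ('a, 'b) fock"
  assume X: "Cauchy X"
  have "Cauchy (\<lambda>n. coeff (X n) w)" for w
  proof (rule metric_CauchyI)
    fix e :: real assume "e > 0"
    then obtain N where N: "\<And>m n. m \<ge> N \<Longrightarrow> n \<ge> N \<Longrightarrow> dist (X m) (X n) < e"
      using metric_CauchyD[OF X] by blast
    have "dist (coeff (X m) w) (coeff (X n) w) \<le> dist (X m) (X n)" for m n
      using norm_coeff_le[of "X m - X n" w]
      by (simp add: dist_fock_def dist_norm coeff_simps)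
    then show "\<exists>N. \<forall>m\<ge>N. \<forall>n\<ge>N. dist (coeff (X m) w) (coeff (X n) w) < e"
      using N by (meson le_less_trans)
  qed
  then have "\<forall>w. \<exists>l. (\<lambda>n. coeff (X n) w) \<longlonglongrightarrow> l"
    by (simp add: Cauchy_convergent_iff convergent_def)
  then obtain l where l: "\<And>w. (\<lambda>n. coeff (X n) w) \<longlonglongrightarrow> l w"
    by metis
  have main: "\<exists>N. \<forall>n\<ge>N. \<forall>A. L2_set (\<lambda>w. norm (coeff (X n) w - l w)) A \<le> e"
    if e: "e > 0" for e
  proof -
    obtain N where N: "\<And>m n. m \<ge> N \<Longrightarrow> n \<ge> N \<Longrightarrow> dist (X m) (X n) < e"
      using metric_CauchyD[OF X e] by blast
    have "L2_set (\<lambda>w. norm (coeff (X n) w - l w)) A \<le> e" if n: "n \<ge> N" for n A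
    proof (rule LIMSEQ_le_const2)
      show "(\<lambda>m. L2_set (\<lambda>w. norm (coeff (X n) w - coeff (X m) w)) A)
              \<longlonglongrightarrow> L2_set (\<lambda>w. norm (coeff (X n) w - l w)) A"
        unfolding L2_set_def by (intro tendsto_intros l)
      have "L2_set (\<lambda>w. norm (coeff (X n) w - coeff (X m) w)) A \<le> e" if "m \<ge> N" for m
      proof -
        have "L2_set (\<lambda>w. norm (coeff (X n - X m) w)) A \<le> norm (X n - X m)"
          using L2_set_le_norm[OF coeff_summable[of "X n - X m"]] by (simp add: norm_fock_def)
        also have "\<dots> \<le> e"
          using N[OF n that] by (simp add: dist_fock_def)
        finally show ?thesis by (simp add: coeff_simps)
      qed
      then show "\<exists>N. \<forall>m\<ge>N. L2_set (\<lambda>w. norm (coeff (X n) w - coeff (X m) w)) A \<le> e"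
        by blast
    qed
    then show ?thesis by blast
  qed
  obtain n0 where n0: "\<And>A. L2_set (\<lambda>w. norm (coeff (X n0) w - l w)) A \<le> 1"
    using main[of 1] by auto
  have "(\<lambda>w. (norm (coeff (X n0) w - (coeff (X n0) w - l w)))\<^sup>2) summable_on UNIV"
    by (intro square_summable_diff coeff_summable square_summable_bounded(1)[OF n0])
  then have lc: "coeff (Fock l) = l"
    by (simp add: Fock_inverse)
  have "X \<longlonglongrightarrow> Fock l"
  proof (rule metric_LIMSEQ_I)
    fix e :: real assume "e > 0"
    then obtain N where N: "\<And>n A. n \<ge> N \<Longrightarrow> L2_set (\<lambda>w. norm (coeff (X n) w - l w)) A \<le> e / 2"
      using main[of "e / 2"] by auto
    have "dist (X n) (Fock l) < e" if "n \<ge> N" for n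
    proof -
      have "norm (X n - Fock l) \<le> e / 2"
        unfolding norm_fock_def coeff_simps lc
        by (rule square_summable_bounded(2)) (rule N[OF that])
      then show ?thesis using \<open>e > 0\<close> by (simp add: dist_fock_def)
    qed
    then show "\<exists>N. \<forall>n\<ge>N. dist (X n) (Fock l) < e" by blast
  qed
  then show "convergent X" by (rule convergentI)
qed

instantiation fock :: (type, complex_hilbert) complex_hilbert
begin

lift_definition scaleC_fock :: "complex \<Rightarrow> ('a, 'b) fock \<Rightarrow> ('a, 'b) fock"
  is "\<lambda>c f w. c *\<^sub>C f w"
  by (simp add: square_summable_scaleC)

definition cinner_fock :: "('a, 'b) fock \<Rightarrow> ('a, 'b) fock \<Rightarrow> complex" where
  "cinner_fock f g = (\<Sum>\<^sub>\<infinity>w. cinner (coeff f w) (coeff g w))"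

instance
proof
  fix f g h :: "('a, 'b) fock" and c :: complex and r :: real
  show "r *\<^sub>R f = complex_of_real r *\<^sub>C f"
    by (rule fock_eqI) (simp add: coeff_simps scaleC_fock.rep_eq scaleR_scaleC)
  show "cinner f g = cnj (cinner g f)"
    unfolding cinner_fock_def infsum_cnj[symmetric] by (simp add: cinner_commute[symmetric])
  show "cinner f (g + h) = cinner f g + cinner f h"
    unfolding cinner_fock_def
    by (simp add: coeff_simps scaleC_fock.rep_eq cinner_add_right infsum_add cinner_summable coeff_summable)
  show "cinner f (c *\<^sub>C g) = c * cinner f g"
    unfolding cinner_fock_def
    by (simp add: coeff_simps scaleC_fock.rep_eq cinner_scaleC_right infsum_cmult_right')
  have "((\<lambda>w. complex_of_real ((norm (coeff f w))\<^sup>2)) has_sum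
          complex_of_real (\<Sum>\<^sub>\<infinity>w. (norm (coeff f w))\<^sup>2)) UNIV"
    by (rule has_sum_of_real) (rule has_sum_infsum[OF coeff_summable])
  then show "cinner f f = complex_of_real ((norm f)\<^sup>2)"
    unfolding cinner_fock_def norm_fock_def
    by (simp add: cinner_self infsumI infsum_nonneg del: of_real_power)
qed (rule fock_eqI, simp add: coeff_simps scaleC_fock.rep_eq scaleC_add_right scaleC_add_left
    scaleC_scaleC)+

end

lemma norm_fock_sq: "(norm f)\<^sup>2 = (\<Sum>\<^sub>\<infinity>w. (norm (coeff f w))\<^sup>2)"
  by (simp add: norm_fock_def infsum_nonneg)

text \<open>Right multiplication by the letter \<open>k\<close>, tensored with the identity: the coefficient
  of \<open>v\<close> moves to the word \<open>v k\<close>.\<close>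

lift_definition right_shift :: "'d \<Rightarrow> ('d, 'f::complex_hilbert) fock \<Rightarrow> ('d, 'f) fock"
  is "\<lambda>k f w. if w \<noteq> [] \<and> last w = k then f (butlast w) else 0"
proof -
  fix k :: 'd and f :: "'d list \<Rightarrow> 'f"
  assume "(\<lambda>w. (norm (f w))\<^sup>2) summable_on UNIV"
  then have "((\<lambda>w. (norm (f (butlast w)))\<^sup>2) \<circ> (\<lambda>v. v @ [k])) summable_on UNIV"
    by (simp add: o_def)
  then have "(\<lambda>w. (norm (f (butlast w)))\<^sup>2) summable_on range (\<lambda>v. v @ [k])"
    by (subst summable_on_reindex) (auto simp: inj_on_def)
  also have "?this \<longleftrightarrow>
      (\<lambda>w. (norm (if w \<noteq> [] \<and> last w = k then f (butlast w) else 0))\<^sup>2) summable_on UNIV"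
    by (rule summable_on_cong_neutral) (auto simp: image_iff, metis append_butlast_last_id)
  finally show "(\<lambda>w. (norm (if w \<noteq> [] \<and> last w = k then f (butlast w) else 0))\<^sup>2)
      summable_on UNIV" .
qed

lemma coeff_right_shift:
  "coeff (right_shift k f) w = (if w \<noteq> [] \<and> last w = k then coeff f (butlast w) else 0)"
  by (simp add: right_shift.rep_eq)

text \<open>Coefficientwise identification of the Fock space over a direct sum with the direct
  sum of the Fock spaces.\<close>

lift_definition fock_fst :: "('d, 'f::complex_hilbert \<times> 'g::complex_hilbert) fock \<Rightarrow> ('d, 'f) fock"
  is "\<lambda>f w. fst (f w)"
  by (rule summable_on_comparison_test, assumption) (auto simp: norm_prod_def)

lift_definition fock_snd :: "('d, 'f::complex_hilbert \<times> 'g::complex_hilbert) fock \<Rightarrow> ('d, 'g) fock"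
  is "\<lambda>f w. snd (f w)"
  by (rule summable_on_comparison_test, assumption) (auto simp: norm_prod_def)

lift_definition fock_pair ::
  "('d, 'f::complex_hilbert) fock \<Rightarrow> ('d, 'g::complex_hilbert) fock \<Rightarrow> ('d, 'f \<times> 'g) fock"
  is "\<lambda>f g w. (f w, g w)"
  by (simp add: norm_prod_def summable_on_add)

section \<open>Operators and left multipliers\<close>

definition bounded_clinear :: "('a::complex_hilbert \<Rightarrow> 'b::complex_hilbert) \<Rightarrow> bool" where
  "bounded_clinear T \<longleftrightarrow> bounded_linear T \<and> (\<forall>c x. T (c *\<^sub>C x) = c *\<^sub>C T x)"

definition isometry :: "('a::complex_hilbert \<Rightarrow> 'b::complex_hilbert) \<Rightarrow> bool" where
  "isometry T \<longleftrightarrow> bounded_clinear T \<and> (\<forall>x. norm (T x) = norm x)"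

definition unitary :: "('a::complex_hilbert \<Rightarrow> 'b::complex_hilbert) \<Rightarrow> bool" where
  "unitary T \<longleftrightarrow> isometry T \<and> surj T"

definition ker :: "('a::complex_hilbert \<Rightarrow> 'b::complex_hilbert) \<Rightarrow> 'a set" where
  "ker T = {x. T x = 0}"

definition orth_compl :: "'a::complex_hilbert set \<Rightarrow> 'a set" where
  "orth_compl S = {x. \<forall>s\<in>S. cinner s x = 0}"

definition orth_proj :: "'a::complex_hilbert set \<Rightarrow> 'a \<Rightarrow> 'a" where
  "orth_proj S x = (THE y. y \<in> S \<and> x - y \<in> orth_compl S)"

definition left_multiplier ::
  "(('d, 'f::complex_hilbert) fock \<Rightarrow> ('d, 'j::complex_hilbert) fock) \<Rightarrow> bool" where
  "left_multiplier F \<longleftrightarrow> bounded_clinear F \<and> (\<forall>k x. F (right_shift k x) = right_shift k (F x))"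

definition left_inner ::
  "(('d, 'f::complex_hilbert) fock \<Rightarrow> ('d, 'j::complex_hilbert) fock) \<Rightarrow> bool" where
  "left_inner F \<longleftrightarrow> left_multiplier F \<and> isometry F"

definition row_op ::
  "(('d, 'f::complex_hilbert) fock \<Rightarrow> ('d, 'j::complex_hilbert) fock) \<Rightarrow>
   (('d, 'g::complex_hilbert) fock \<Rightarrow> ('d, 'j) fock) \<Rightarrow> ('d, 'f \<times> 'g) fock \<Rightarrow> ('d, 'j) fock"
  (infixr "\<or>\<^sub>L" 65) where
  "(F \<or>\<^sub>L G) x = F (fock_fst x) + G (fock_snd x)"

definition column_op ::
  "(('d, 'h::complex_hilbert) fock \<Rightarrow> ('d, 'i::complex_hilbert) fock) \<Rightarrow>
   (('d, 'h) fock \<Rightarrow> ('d, 'j::complex_hilbert) fock) \<Rightarrow> ('d, 'h) fock \<Rightarrow> ('d, 'i \<times> 'j) fock" where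
  "column_op A B x = fock_pair (A x) (B x)"

definition diag_op ::
  "(('d, 'f::complex_hilbert) fock \<Rightarrow> ('d, 'i::complex_hilbert) fock) \<Rightarrow>
   (('d, 'g::complex_hilbert) fock \<Rightarrow> ('d, 'j::complex_hilbert) fock) \<Rightarrow>
   ('d, 'f \<times> 'g) fock \<Rightarrow> ('d, 'i \<times> 'j) fock" where
  "diag_op F G x = fock_pair (F (fock_fst x)) (G (fock_snd x))"

section \<open>Operator range spaces and the de Branges--Beurling construction\<close>

text \<open>A subspace of \<^typ>\<open>'a\<close> together with a norm of its own (only the values of the norm
  on the subspace matter).\<close>

type_synonym 'a normed_subspace = "'a set \<times> ('a \<Rightarrow> real)"

definition range_norm :: "('a::complex_hilbert \<Rightarrow> 'b::complex_hilbert) \<Rightarrow> 'b \<Rightarrow> real" where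
  "range_norm F h = (THE r. \<exists>x. F x = h \<and> r = norm (orth_proj (orth_compl (ker F)) x))"

definition range_space :: "('a::complex_hilbert \<Rightarrow> 'b::complex_hilbert) \<Rightarrow> 'b normed_subspace" where
  "range_space F = (range F, range_norm F)"

definition meet_space :: "'a normed_subspace \<Rightarrow> 'a normed_subspace \<Rightarrow> 'a normed_subspace" where
  "meet_space M N = (fst M \<inter> fst N, \<lambda>h. sqrt ((snd M h)\<^sup>2 + (snd N h)\<^sup>2))"

text \<open>\<open>word_op X [i\<^sub>1, \<dots>, i\<^sub>n] = X i\<^sub>1 \<circ> \<dots> \<circ> X i\<^sub>n\<close>\<close>

definition word_op :: "('d \<Rightarrow> 'a \<Rightarrow> 'a) \<Rightarrow> 'd list \<Rightarrow> 'a \<Rightarrow> 'a" where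
  "word_op X w = foldr X w"

definition row_isometry :: "('d \<Rightarrow> 'k::complex_hilbert \<Rightarrow> 'k) \<Rightarrow> bool" where
  "row_isometry V \<longleftrightarrow> (\<forall>i. isometry (V i)) \<and>
     (\<forall>i j x y. i \<noteq> j \<longrightarrow> cinner (V i x) (V j y) = 0)"

text \<open>The dilation space is the whole type \<^typ>\<open>'k\<close>; it contains the Hilbert space \<open>M\<close> via the
  linear isometry \<open>\<iota>\<close>, which is only relevant on \<open>M\<close>. Since the norm of \<open>M\<close> comes from an
  inner product, preserving the norm amounts to preserving the inner product.\<close>

definition isometric_embedding ::
  "'a::complex_hilbert normed_subspace \<Rightarrow> ('a \<Rightarrow> 'k::complex_hilbert) \<Rightarrow> bool" where
  "isometric_embedding M \<iota> \<longleftrightarrow>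
     (\<forall>x\<in>fst M. \<forall>y\<in>fst M. \<iota> (x + y) = \<iota> x + \<iota> y) \<and>
     (\<forall>c. \<forall>x\<in>fst M. \<iota> (c *\<^sub>C x) = c *\<^sub>C \<iota> x) \<and>
     (\<forall>x\<in>fst M. norm (\<iota> x) = snd M x)"

definition row_isometric_dilation ::
  "'a::complex_hilbert normed_subspace \<Rightarrow> ('d \<Rightarrow> 'a \<Rightarrow> 'a) \<Rightarrow>
   ('a \<Rightarrow> 'k::complex_hilbert) \<Rightarrow> ('d \<Rightarrow> 'k \<Rightarrow> 'k) \<Rightarrow> bool" where
  "row_isometric_dilation M X \<iota> V \<longleftrightarrow>
     isometric_embedding M \<iota> \<and> row_isometry V \<and>
     (\<forall>w. \<forall>m\<in>fst M. orth_proj (\<iota> ` fst M) (word_op V w (\<iota> m)) = \<iota> (word_op X w m))"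

definition minimal_row_isometric_dilation ::
  "'a::complex_hilbert normed_subspace \<Rightarrow> ('d \<Rightarrow> 'a \<Rightarrow> 'a) \<Rightarrow>
   ('a \<Rightarrow> 'k::complex_hilbert) \<Rightarrow> ('d \<Rightarrow> 'k \<Rightarrow> 'k) \<Rightarrow> bool" where
  "minimal_row_isometric_dilation M X \<iota> V \<longleftrightarrow>
     row_isometric_dilation M X \<iota> V \<and>
     closure (complex_vector.span (\<Union>w. word_op V w ` \<iota> ` fst M)) = UNIV"

text \<open>\<open>H\<close> arises from \<open>M\<close> by the de Branges--Beurling construction with dilation \<open>V\<close> and
  unitary \<open>U\<close>. The value of \<open>P\<^sub>M\<close> at \<open>y\<close>, included into the Fock space, is the element of
  \<open>M\<close> that \<open>\<iota>\<close> sends to the orthogonal projection of \<open>y\<close> onto \<open>\<iota> M\<close>.\<close>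

definition de_Branges_Beurling ::
  "('d, 'j::complex_hilbert) fock normed_subspace \<Rightarrow> (('d, 'j) fock \<Rightarrow> 'k::complex_hilbert) \<Rightarrow>
   ('d \<Rightarrow> 'k \<Rightarrow> 'k) \<Rightarrow> (('d, 'h::complex_hilbert) fock \<Rightarrow> 'k) \<Rightarrow>
   (('d, 'h) fock \<Rightarrow> ('d, 'j) fock) \<Rightarrow> bool" where
  "de_Branges_Beurling M \<iota> V U H \<longleftrightarrow>
     minimal_row_isometric_dilation M right_shift \<iota> V \<and>
     unitary U \<and> (\<forall>k x. U (right_shift k x) = V k (U x)) \<and>
     (\<forall>x. H x = inv_into (fst M) \<iota> (orth_proj (\<iota> ` fst M) (U x)))"

text \<open>\<open>H = F \<and> G\<close>, where the choices \<open>\<iota>\<close>, \<open>V\<close>, \<open>U\<close> made in the construction are explicit. That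
  such an \<open>H\<close> is a left multiplier with operator range space
  \<open>meet_space (range_space F) (range_space G)\<close> is a consequence.\<close>

definition is_wedge ::
  "(('d, 'f::complex_hilbert) fock \<Rightarrow> ('d, 'j::complex_hilbert) fock) \<Rightarrow>
   (('d, 'g::complex_hilbert) fock \<Rightarrow> ('d, 'j) fock) \<Rightarrow>
   (('d, 'j) fock \<Rightarrow> 'k::complex_hilbert) \<Rightarrow> ('d \<Rightarrow> 'k \<Rightarrow> 'k) \<Rightarrow>
   (('d, 'h::complex_hilbert) fock \<Rightarrow> 'k) \<Rightarrow>
   (('d, 'h) fock \<Rightarrow> ('d, 'j) fock) \<Rightarrow> bool" where
  "is_wedge F G \<iota> V U H \<longleftrightarrow>
     de_Branges_Beurling (meet_space (range_space F) (range_space G)) \<iota> V U H"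

end

theory Submission
  imports Defs
begin

text \<open>
  Write \<open>M\<close> for the meet of the two range spaces. Sending \<open>h\<close> in \<open>M\<close> to \<open>(f, -g)\<close>, where \<open>f\<close> and
  \<open>g\<close> are the preimages of \<open>h\<close> of least norm under \<open>F\<close> and \<open>G\<close>, embeds \<open>M\<close> isometrically into
  \<open>ker (F \<or> G)\<close>, with orthogonal complement \<open>ker F \<oplus> ker G\<close> there. Both \<open>ker (F \<or> G)\<close> and this
  complement are invariant under the right shifts, which therefore form on \<open>ker (F \<or> G)\<close> a row
  isometric dilation of their restriction to \<open>M\<close>. By minimality the given dilation \<open>V\<close> embeds into
  this one through an intertwining isometry \<open>W\<close>, and \<open>\<Gamma> = W U\<close>.
\<close>

section \<open>Complex Hilbert spaces\<close>

lemma scaleC_minus_one: "(- 1) *\<^sub>C x = - (x::'a::complex_hilbert)"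
  using complex_vector.scale_minus_left[of 1 x] by (simp add: scaleC_one)

lemma cinner_zero_right [simp]: "cinner x (0::'a::complex_hilbert) = 0"
  using cinner_add_right[of x 0 0] by simp

lemma cinner_zero_left [simp]: "cinner (0::'a::complex_hilbert) x = 0"
  using cinner_add_left[of 0 0 x] by simp

lemma cinner_minus_right: "cinner x (- y) = - cinner x (y::'a::complex_hilbert)"
  using cinner_add_right[of x y "- y"] by (simp add: eq_neg_iff_add_eq_0 add.commute)

lemma cinner_diff_right: "cinner x (y - z) = cinner x y - cinner x (z::'a::complex_hilbert)"
  using cinner_add_right[of x y "- z"] by (simp add: cinner_minus_right)

lemma norm_add_sq:
  fixes x y :: "'a::complex_hilbert"
  shows "(norm (x + y))\<^sup>2 = (norm x)\<^sup>2 + (norm y)\<^sup>2 + 2 * Re (cinner x y)"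
proof -
  have "complex_of_real ((norm (x + y))\<^sup>2) = cinner x x + cinner y y + (cinner x y + cnj (cinner x y))"
    by (simp add: cinner_self[symmetric] cinner_add_left cinner_add_right
        cinner_commute[of y x] del: of_real_power)
  then have "Re (complex_of_real ((norm (x + y))\<^sup>2))
      = Re (cinner x x + cinner y y + (cinner x y + cnj (cinner x y)))"
    by (rule arg_cong)
  then show ?thesis
    by (simp add: cinner_self del: of_real_power)
qed

lemma norm_diff_sq:
  fixes x y :: "'a::complex_hilbert"
  shows "(norm (x - y))\<^sup>2 = (norm x)\<^sup>2 + (norm y)\<^sup>2 - 2 * Re (cinner x y)"
  using norm_add_sq[of x "- y"] by (simp add: cinner_minus_right)

lemma cinner_eq_0_self: "cinner x x = 0 \<Longrightarrow> x = (0::'a::complex_hilbert)"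
  by (simp add: cinner_self)

lemma bounded_linear_cinner: "bounded_linear (cinner (x::'a::complex_hilbert))"
proof (rule bounded_linear_intro)
  fix y :: 'a
  \<comment> \<open>The imaginary part is, up to sign, the real part for
    \<open>\<i> *\<^sub>C y\<close>; adding the two bounds produces the factor 2.\<close>
  have "\<bar>Im (cinner x y)\<bar> = \<bar>Re (cinner x (\<i> *\<^sub>C y))\<bar>"
    by (simp add: cinner_scaleC_right)
  also have "\<dots> \<le> norm x * norm y"
    using Re_cinner_bound[of x "\<i> *\<^sub>C y"] by (simp add: norm_scaleC)
  finally show "norm (cinner x y) \<le> norm y * (2 * norm x)"
    using Re_cinner_bound[of x y] cmod_le[of "cinner x y"] by (simp add: algebra_simps)
qed (simp_all add: cinner_add_right scaleR_scaleC cinner_scaleC_right scaleC_complex_def)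

text \<open>Polarisation: the norm of the sum determines the real part, and the sum with the second
  vector turned by \<open>\<i>\<close> determines the imaginary part. Embeddings that are specified
  only through norms thereby preserve inner products.\<close>

lemma cinner_eq_of_norm_eq:
  fixes x y :: "'a::complex_hilbert" and x' y' :: "'b::complex_hilbert"
  assumes "norm x = norm x'" "norm y = norm y'" "norm (x + y) = norm (x' + y')"
    and "norm (x + \<i> *\<^sub>C y) = norm (x' + \<i> *\<^sub>C y')"
  shows "cinner x y = cinner x' y'"
proof (rule complex_eqI)
  show "Re (cinner x y) = Re (cinner x' y')"
    using norm_add_sq[of x y] norm_add_sq[of x' y'] assms by simp
  show "Im (cinner x y) = Im (cinner x' y')"
    using norm_add_sq[of x "\<i> *\<^sub>C y"] norm_add_sq[of x' "\<i> *\<^sub>C y'"] assms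
    by (simp add: norm_scaleC cinner_scaleC_right)
qed

section \<open>Orthogonal complements and projections onto closed subspaces\<close>

lemma orth_compl_subspace: "complex_vector.subspace (orth_compl S)"
  by (rule complex_vector.subspaceI)
    (auto simp: orth_compl_def cinner_add_right cinner_scaleC_right)

lemma closed_orth_compl: "closed (orth_compl S)"
proof -
  have "orth_compl S = (\<Inter>s\<in>S. {x. cinner s x = 0})"
    by (auto simp: orth_compl_def)
  moreover have "closed {x. cinner s x = 0}" for s :: 'a
    by (intro closed_Collect_eq continuous_on_const linear_continuous_on bounded_linear_cinner)
  ultimately show ?thesis by (simp add: closed_INT)
qed

text \<open>A sequence in \<open>S\<close> minimising the distance to \<open>x\<close> is Cauchy by
  the parallelogram law. Its limit is a nearest point, and the difference to \<open>x\<close> is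
  orthogonal to \<open>S\<close>, since otherwise a small move inside \<open>S\<close> would come
  closer.\<close>

lemma orth_projection_exists:
  fixes S :: "'a::complex_hilbert set"
  assumes S: "complex_vector.subspace S" and "closed S"
  shows "\<exists>y\<in>S. x - y \<in> orth_compl S"
proof -
  define d where "d = infdist x S"
  have ne: "S \<noteq> {}"
    using complex_vector.subspace_0[OF S] by auto
  have d: "d \<le> norm (x - s)" if "s \<in> S" for s
    using infdist_le[OF that, of x] by (simp add: d_def dist_norm)
  have d0: "d \<ge> 0"
    by (simp add: d_def infdist_nonneg)
  have "\<exists>s\<in>S. norm (x - s) < d + 1 / real (Suc n)" for n
  proof (rule ccontr)
    assume "\<not> ?thesis"
    then have "d + 1 / real (Suc n) \<le> infdist x S"
      using ne by (auto simp: infdist_notempty dist_norm not_less intro!: cINF_greatest)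
    then show False
      by (simp add: d_def)
  qed
  then obtain s where s: "\<And>n. s n \<in> S" and sd: "\<And>n. norm (x - s n) < d + 1 / real (Suc n)"
    by metis
  have sd2: "(\<lambda>n. norm (x - s n)) \<longlonglongrightarrow> d"
  proof (rule tendsto_sandwich[where f = "\<lambda>_. d" and h = "\<lambda>n. d + 1 / real (Suc n)"])
    show "(\<lambda>n. d + 1 / real (Suc n)) \<longlonglongrightarrow> d"
      using tendsto_add[OF tendsto_const LIMSEQ_Suc[OF lim_1_over_n], of d] by simp
  qed (simp_all add: d s less_imp_le[OF sd] del: of_nat_Suc)
  \<comment> \<open>The midpoint of \<open>s m\<close> and \<open>s n\<close> lies in
    \<open>S\<close>, so its distance to \<open>x\<close> is at least \<open>d\<close>; the
    parallelogram law turns this into an upper bound for the distance of the two points.\<close>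
  have par: "(norm (s m - s n))\<^sup>2 \<le> 2 * (norm (x - s m))\<^sup>2 + 2 * (norm (x - s n))\<^sup>2 - 4 * d\<^sup>2" for m n
  proof -
    have "(1/2) *\<^sub>C (s m + s n) \<in> S"
      by (intro complex_vector.subspace_scale complex_vector.subspace_add S s)
    then have "d \<le> norm (x - (1/2) *\<^sub>R (s m + s n))"
      using d by (simp add: scaleR_scaleC)
    then have "d\<^sup>2 \<le> (norm (x - (1/2) *\<^sub>R (s m + s n)))\<^sup>2"
      using d0 by (rule power_mono)
    also have "x - (1/2) *\<^sub>R (s m + s n) = (1/2) *\<^sub>R ((x - s m) + (x - s n))"
      by (simp add: algebra_simps flip: scaleR_add_left)
    finally have "4 * d\<^sup>2 \<le> (norm ((x - s m) + (x - s n)))\<^sup>2"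
      by (simp add: power_divide)
    moreover have "s m - s n = (x - s n) - (x - s m)"
      by simp
    then have "(norm (s m - s n))\<^sup>2 = (norm ((x - s m) - (x - s n)))\<^sup>2"
      by (metis norm_minus_commute)
    ultimately show ?thesis
      using norm_add_sq[of "x - s m" "x - s n"] norm_diff_sq[of "x - s m" "x - s n"] by linarith
  qed
  have "Cauchy s"
  proof (rule CauchyI)
    fix e :: real assume e: "e > 0"
    have "(\<lambda>n. (norm (x - s n))\<^sup>2) \<longlonglongrightarrow> d\<^sup>2"
      by (intro tendsto_intros sd2)
    moreover have "d\<^sup>2 < d\<^sup>2 + e\<^sup>2 / 4"
      using e by simp
    ultimately obtain N where N: "\<And>n. n \<ge> N \<Longrightarrow> (norm (x - s n))\<^sup>2 < d\<^sup>2 + e\<^sup>2 / 4"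
      by (metis (no_types, lifting) order_tendstoD(2) eventually_sequentially)
    have "norm (s m - s n) < e" if "m \<ge> N" "n \<ge> N" for m n
    proof (rule power_less_imp_less_base)
      show "(norm (s m - s n))\<^sup>2 < e\<^sup>2"
        using par[of m n] N[OF that(1)] N[OF that(2)] by linarith
    qed (use e in simp)
    then show "\<exists>M. \<forall>m\<ge>M. \<forall>n\<ge>M. norm (s m - s n) < e"
      by blast
  qed
  then obtain y where y: "s \<longlonglongrightarrow> y"
    by (auto simp: Cauchy_convergent_iff convergent_def)
  have yS: "y \<in> S"
    using closed_sequentially[OF \<open>closed S\<close> _ y] s by blast
  have "(\<lambda>n. norm (x - s n)) \<longlonglongrightarrow> norm (x - y)"
    by (intro tendsto_intros y)
  then have xy: "norm (x - y) = d"
    using sd2 LIMSEQ_unique by blast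
  have "cinner t (x - y) = 0" if t: "t \<in> S" for t
  proof (rule ccontr)
    assume nz: "cinner t (x - y) \<noteq> 0"
    define a where "a = cinner t (x - y)"
    define T where "T = (norm t)\<^sup>2"
    have "t \<noteq> 0"
      using nz by auto
    then have T: "T > 0"
      by (simp add: T_def)
    \<comment> \<open>With this coefficient \<open>c *\<^sub>C t\<close> is the projection of
      \<open>x - y\<close> onto the line through \<open>t\<close>. Adding it to \<open>y\<close>
      would lower the squared distance by \<open>(cmod a)\<^sup>2 / T\<close>, which contradicts the
      minimality of \<open>d\<close>.\<close>
    define c where "c = a / complex_of_real T"
    have "y + c *\<^sub>C t \<in> S"
      by (intro complex_vector.subspace_scale complex_vector.subspace_add S yS t)
    then have "d \<le> norm ((x - y) - c *\<^sub>C t)"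
      using d[of "y + c *\<^sub>C t"] by (simp add: algebra_simps)
    then have "d\<^sup>2 \<le> (norm ((x - y) - c *\<^sub>C t))\<^sup>2"
      using d0 by (rule power_mono)
    also have "\<dots> = d\<^sup>2 + (cmod c)\<^sup>2 * T - 2 * Re (c * cnj a)"
      by (simp add: norm_diff_sq xy norm_scaleC T_def power_mult_distrib cinner_scaleC_right
          a_def cinner_commute[of "x - y"])
    also have "c * cnj a = complex_of_real ((cmod a)\<^sup>2 / T)"
      by (simp add: c_def complex_norm_square flip: of_real_power)
    also have "(cmod c)\<^sup>2 * T = (cmod a)\<^sup>2 / T"
      using T by (simp add: c_def norm_divide power_divide power2_eq_square)
    finally have "(cmod a)\<^sup>2 / T \<le> 0"
      by simp
    then show False
      using T nz by (simp add: a_def divide_le_0_iff)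
  qed
  then show ?thesis
    using yS by (auto simp: orth_compl_def)
qed

text \<open>Two candidates differ by a vector that lies both in \<open>S\<close> and in its
  orthogonal complement, hence is orthogonal to itself. So any candidate found by hand is the value
  of the definite description.\<close>

lemma orth_proj_eqI:
  fixes S :: "'a::complex_hilbert set"
  assumes "complex_vector.subspace S" "y \<in> S" "x - y \<in> orth_compl S"
  shows "orth_proj S x = y"
  unfolding orth_proj_def
proof (rule the_equality)
  fix z assume z: "z \<in> S \<and> x - z \<in> orth_compl S"
  have "(x - y) - (x - z) \<in> orth_compl S"
    using z assms(3) complex_vector.subspace_diff[OF orth_compl_subspace] by blast
  moreover have "z - y \<in> S"
    using z assms complex_vector.subspace_diff by blast
  ultimately have "cinner (z - y) (z - y) = 0"
    by (auto simp: orth_compl_def)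
  then show "z = y"
    using cinner_eq_0_self[of "z - y"] by simp
qed (use assms in blast)

lemma orth_proj:
  fixes S :: "'a::complex_hilbert set"
  assumes "complex_vector.subspace S" "closed S"
  shows "orth_proj S x \<in> S" "x - orth_proj S x \<in> orth_compl S"
  using orth_projection_exists[OF assms, of x] orth_proj_eqI[OF assms(1)] by metis+

section \<open>Bounded operators\<close>

lemma bounded_clinearD:
  assumes "bounded_clinear T"
  shows "T (x + y) = T x + T y" "T (x - y) = T x - T y" "T (- x) = - T x" "T 0 = 0"
    and "T (c *\<^sub>C x) = c *\<^sub>C T x"
proof -
  interpret bounded_linear T
    using assms by (simp add: bounded_clinear_def)
  show "T (x + y) = T x + T y" "T (x - y) = T x - T y" "T (- x) = - T x" "T 0 = 0"
    by (simp_all add: add diff neg zero)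
  show "T (c *\<^sub>C x) = c *\<^sub>C T x"
    using assms by (simp add: bounded_clinear_def)
qed

lemma bounded_clinearI:
  assumes "\<And>x y. T (x + y) = T x + T y" "\<And>c x. T (c *\<^sub>C x) = c *\<^sub>C T x"
    and "\<And>x. norm (T x) \<le> norm x"
  shows "bounded_clinear T"
  unfolding bounded_clinear_def
  using assms by (auto intro!: bounded_linear_intro[where K = 1] simp: scaleR_scaleC)

lemma isometryI:
  assumes "\<And>x y. T (x + y) = T x + T y" "\<And>c x. T (c *\<^sub>C x) = c *\<^sub>C T x"
    and "\<And>x. norm (T x) = norm x"
  shows "isometry T"
  unfolding isometry_def using assms by (auto intro: bounded_clinearI)

lemma bounded_clinear_compose:
  "bounded_clinear S \<Longrightarrow> bounded_clinear T \<Longrightarrow> bounded_clinear (\<lambda>x. S (T x))"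
  unfolding bounded_clinear_def by (auto intro: bounded_linear_compose)

lemma bounded_clinear_add:
  "bounded_clinear S \<Longrightarrow> bounded_clinear T \<Longrightarrow> bounded_clinear (\<lambda>x. S x + T x)"
  unfolding bounded_clinear_def by (auto intro: bounded_linear_add simp: scaleC_add_right)

lemma bounded_clinear_zero: "bounded_clinear (\<lambda>x. 0)"
  unfolding bounded_clinear_def by (auto intro: bounded_linear_zero)

lemma isometry_cinner: "isometry T \<Longrightarrow> cinner (T x) (T y) = cinner x y"
  unfolding isometry_def
  by (rule cinner_eq_of_norm_eq) (metis bounded_clinearD(1,5))+

lemma tendsto_bounded_clinear:
  "bounded_clinear T \<Longrightarrow> (f \<longlongrightarrow> a) A \<Longrightarrow> ((\<lambda>x. T (f x)) \<longlongrightarrow> T a) A"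
  unfolding bounded_clinear_def by (blast intro: bounded_linear.tendsto)

lemma ker_subspace: "bounded_clinear T \<Longrightarrow> complex_vector.subspace (ker T)"
  by (rule complex_vector.subspaceI) (auto simp: ker_def bounded_clinearD)

lemma closed_ker: "bounded_clinear T \<Longrightarrow> closed (ker T)"
  unfolding ker_def bounded_clinear_def
  by (intro closed_Collect_eq continuous_on_const linear_continuous_on) auto

text \<open>The set where two bounded operators agree is a closed subspace. In the main proof
  \<open>A\<close> is the set of words of the dilation applied to the embedded meet space, which is
  total by minimality.\<close>

lemma bounded_clinear_eq_on_dense:
  assumes S: "bounded_clinear S" and T: "bounded_clinear T"
    and eq: "\<And>x. x \<in> A \<Longrightarrow> S x = T x"
    and dense: "closure (complex_vector.span A) = UNIV"
  shows "S x = T x"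
proof -
  have "complex_vector.subspace {x. S x = T x}"
    by (rule complex_vector.subspaceI) (auto simp: bounded_clinearD[OF S] bounded_clinearD[OF T])
  then have "complex_vector.span A \<subseteq> {x. S x = T x}"
    using eq by (intro complex_vector.span_minimal) auto
  moreover have "closed {x. S x = T x}"
    using S T unfolding bounded_clinear_def
    by (intro closed_Collect_eq linear_continuous_on) auto
  ultimately have "closure (complex_vector.span A) \<subseteq> {x. S x = T x}"
    by (rule closure_minimal)
  then show ?thesis
    using dense by auto
qed

section \<open>Isometries from equal Gram matrices\<close>

lemma complex_subspace_closure:
  fixes S :: "'a::complex_hilbert set"
  assumes S: "complex_vector.subspace S"
  shows "complex_vector.subspace (closure S)"
proof (rule complex_vector.subspaceI)
  show "0 \<in> closure S"
    using complex_vector.subspace_0[OF S] closure_subset by blast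
next
  fix x y assume "x \<in> closure S" "y \<in> closure S"
  then obtain f g where "\<And>n. f n \<in> S" "f \<longlonglongrightarrow> x" "\<And>n. g n \<in> S" "g \<longlonglongrightarrow> y"
    by (auto simp: closure_sequential)
  then show "x + y \<in> closure S"
    unfolding closure_sequential
    by (intro exI[of _ "\<lambda>n. f n + g n"]) (auto intro: tendsto_add complex_vector.subspace_add[OF S])
next
  fix c x assume "x \<in> closure S"
  then obtain f where "\<And>n. f n \<in> S" "f \<longlonglongrightarrow> x"
    by (auto simp: closure_sequential)
  moreover have "bounded_clinear ((*\<^sub>C) c :: 'a \<Rightarrow> 'a)"
    unfolding bounded_clinear_def
    by (auto intro!: bounded_linear_intro[where K = "cmod c"]
        simp: scaleC_add_right scaleR_scaleC scaleC_scaleC norm_scaleC mult.commute)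
  ultimately show "c *\<^sub>C x \<in> closure S"
    unfolding closure_sequential
    by (intro exI[of _ "\<lambda>n. c *\<^sub>C f n"])
      (auto intro: tendsto_bounded_clinear complex_vector.subspace_scale[OF S])
qed

text \<open>The isometry is obtained through its graph, the closed span of the pairs \<open>(A i, B i)\<close>.\<close>

lemma isometry_of_gram_eq:
  fixes A :: "'i \<Rightarrow> 'a::complex_hilbert" and B :: "'i \<Rightarrow> 'b::complex_hilbert"
  assumes gram: "\<And>i j. i \<in> I \<Longrightarrow> j \<in> I \<Longrightarrow> cinner (A i) (A j) = cinner (B i) (B j)"
    and dense: "closure (complex_vector.span (A ` I)) = UNIV"
  shows "\<exists>W. isometry W \<and> (\<forall>i\<in>I. W (A i) = B i)"
proof -
  define P where "P = (\<lambda>i. (A i, B i)) ` I"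
  define S where "S = complex_vector.span P"
  have subspace_Q: "complex_vector.subspace {q. cinner (fst p) (fst q) = cinner (snd p) (snd q)}"
    for p :: "'a \<times> 'b"
    by (rule complex_vector.subspaceI) (auto simp: scaleC_prod_def cinner_add_right cinner_scaleC_right)
  \<comment> \<open>For a fixed first argument the identity is linear in the second one. It
    therefore passes from the generators to the span one argument at a time, with conjugate symmetry
    exchanging the arguments for the second pass.\<close>
  have 1: "cinner (fst p) (fst q) = cinner (snd p) (snd q)" if "p \<in> P" "q \<in> S" for p q
  proof -
    have "S \<subseteq> {q. cinner (fst p) (fst q) = cinner (snd p) (snd q)}"
      unfolding S_def using that gram
      by (intro complex_vector.span_minimal subspace_Q) (auto simp: P_def)
    then show ?thesis using that by auto
  qed
  have 2: "cinner (fst p) (fst q) = cinner (snd p) (snd q)" if "p \<in> S" "q \<in> S" for p q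
  proof -
    have "S \<subseteq> {p. cinner (fst q) (fst p) = cinner (snd q) (snd p)}"
      unfolding S_def using 1[OF _ \<open>q \<in> S\<close>]
      by (intro complex_vector.span_minimal subspace_Q)
        (auto simp: cinner_commute[of "fst q"] cinner_commute[of "snd q"])
    then have "cinner (fst q) (fst p) = cinner (snd q) (snd p)" using that by auto
    then show ?thesis by (metis cinner_commute)
  qed
  have norm_S: "norm (fst p) = norm (snd p)" if "p \<in> S" for p
  proof -
    have "(norm (fst p))\<^sup>2 = (norm (snd p))\<^sup>2"
      using 2[OF that that] unfolding cinner_self of_real_eq_iff .
    then show ?thesis by (simp add: power2_eq_iff_nonneg)
  qed
  define C where "C = closure S"
  have subC: "complex_vector.subspace C"
    unfolding C_def S_def by (intro complex_subspace_closure complex_vector.subspace_span)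
  have "closed {p :: 'a \<times> 'b. norm (fst p) = norm (snd p)}"
    by (intro closed_Collect_eq continuous_intros)
  then have norm_C: "norm (fst p) = norm (snd p)" if "p \<in> C" for p
    using closure_minimal[of S "{p. norm (fst p) = norm (snd p)}"] norm_S that
    unfolding C_def by blast
  \<comment> \<open>The difference of the two pairs is \<open>(0, y - z)\<close>, and on
    \<open>C\<close> both components have the same norm.\<close>
  have uniq: "y = z" if "(x, y) \<in> C" "(x, z) \<in> C" for x y z
    using norm_C[OF complex_vector.subspace_diff[OF subC that]] by simp
  have "A ` I \<subseteq> fst ` S"
    using complex_vector.span_superset[of P] by (force simp: S_def P_def)
  moreover have "complex_vector.subspace (fst ` S)"
  proof (rule complex_vector.subspaceI)
    note subS = complex_vector.subspace_span[of P, folded S_def]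
    show "0 \<in> fst ` S"
      using complex_vector.subspace_0[OF subS] by force
    show "x + y \<in> fst ` S" if "x \<in> fst ` S" "y \<in> fst ` S" for x y
      using that complex_vector.subspace_add[OF subS] by force
    show "c *\<^sub>C x \<in> fst ` S" if "x \<in> fst ` S" for c x
      using that complex_vector.subspace_scale[OF subS, of _ c] by (force simp: scaleC_prod_def)
  qed
  ultimately have "complex_vector.span (A ` I) \<subseteq> fst ` S"
    by (rule complex_vector.span_minimal)
  then have dense': "closure (fst ` S) = UNIV"
    using dense closure_mono by blast
  \<comment> \<open>Approximate \<open>x\<close> by first components of points of \<open>S\<close>.
    Equal norms make the second components Cauchy too, and completeness gives the limit pair in
    \<open>C\<close>.\<close>
  have ex: "\<exists>y. (x, y) \<in> C" for x
  proof -
    have "x \<in> closure (fst ` S)"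
      using dense' by simp
    then obtain f where f: "\<And>n. f n \<in> fst ` S" "f \<longlonglongrightarrow> x"
      unfolding closure_sequential by blast
    then have "\<forall>n. \<exists>z. (f n, z) \<in> S" by force
    then obtain g where g: "\<And>n. (f n, g n) \<in> S" by metis
    have "norm (g m - g n) = norm (f m - f n)" for m n
      using norm_S[of "(f m, g m) - (f n, g n)"] complex_vector.span_diff[of "(f m, g m)" P "(f n, g n)"] g
      by (simp add: S_def)
    moreover have "Cauchy f"
      using f(2) by (rule LIMSEQ_imp_Cauchy)
    ultimately have "Cauchy g"
      unfolding Cauchy_def dist_norm by simp
    then obtain y where "g \<longlonglongrightarrow> y"
      by (auto simp: Cauchy_convergent_iff convergent_def)
    then have "(\<lambda>n. (f n, g n)) \<longlonglongrightarrow> (x, y)"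
      using f by (intro tendsto_Pair)
    then have "(x, y) \<in> C"
      unfolding C_def closure_sequential using g by (intro exI[of _ "\<lambda>n. (f n, g n)"]) auto
    then show ?thesis ..
  qed
  define W where "W x = (THE y. (x, y) \<in> C)" for x
  have W: "(x, W x) \<in> C" for x
    unfolding W_def by (rule theI') (use ex[of x] uniq in blast)
  have W_eq: "W x = y" if "(x, y) \<in> C" for x y
    using uniq[OF W that] .
  have "isometry W"
  proof (rule isometryI)
    show "W (x + y) = W x + W y" for x y
      using complex_vector.subspace_add[OF subC W W, of x y] by (intro W_eq) simp
    show "W (c *\<^sub>C x) = c *\<^sub>C W x" for c x
      using complex_vector.subspace_scale[OF subC W, of c x]
      by (intro W_eq) (simp add: scaleC_prod_def)
    show "norm (W x) = norm x" for x
      using norm_C[OF W[of x]] by simp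
  qed
  moreover have "W (A i) = B i" if "i \<in> I" for i
    using that complex_vector.span_superset[of P] closure_subset[of S]
    by (intro W_eq) (auto simp: C_def S_def P_def)
  ultimately show ?thesis by blast
qed

section \<open>The vector-valued Fock space\<close>

lemma coeff_scaleC: "coeff (c *\<^sub>C f) w = c *\<^sub>C coeff f w"
  by (simp add: scaleC_fock.rep_eq)

lemmas fock_coeff_simps = coeff_simps coeff_scaleC coeff_right_shift
  fock_fst.rep_eq fock_snd.rep_eq fock_pair.rep_eq scaleC_prod_def

lemma fock_fst_pair [simp]: "fock_fst (fock_pair f g) = f"
  and fock_snd_pair [simp]: "fock_snd (fock_pair f g) = g"
  by (rule fock_eqI, simp add: fock_coeff_simps)+

lemma fock_pair_add: "fock_pair (f + f') (g + g') = fock_pair f g + fock_pair f' g'"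
  and fock_pair_scaleC: "fock_pair (c *\<^sub>C f) (c *\<^sub>C g) = c *\<^sub>C fock_pair f g"
  and fock_fst_diff: "fock_fst (p - q) = fock_fst p - fock_fst q"
  and fock_snd_diff: "fock_snd (p - q) = fock_snd p - fock_snd q"
  and fock_fst_right_shift: "fock_fst (right_shift k p) = right_shift k (fock_fst p)"
  and fock_snd_right_shift: "fock_snd (right_shift k p) = right_shift k (fock_snd p)"
  by (rule fock_eqI, simp add: fock_coeff_simps)+

lemma norm_fock_decompose: "(norm p)\<^sup>2 = (norm (fock_fst p))\<^sup>2 + (norm (fock_snd p))\<^sup>2"
  unfolding norm_fock_sq
  by (subst infsum_add[symmetric])
    (simp_all add: coeff_summable, simp add: fock_coeff_simps norm_prod_def)

lemma cinner_fock_decompose: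
  "cinner p q = cinner (fock_fst p) (fock_fst q) + cinner (fock_snd p) (fock_snd q)"
  unfolding cinner_fock_def
  by (subst infsum_add[symmetric])
    (simp_all add: cinner_summable coeff_summable, simp add: cinner_prod_def fock_coeff_simps)

lemma bounded_clinear_fock_fst: "bounded_clinear fock_fst"
proof (rule bounded_clinearI)
  fix p :: "('d, 'f::complex_hilbert \<times> 'g::complex_hilbert) fock"
  show "norm (fock_fst p) \<le> norm p"
    by (rule power2_le_imp_le) (simp_all add: norm_fock_decompose)
qed (rule fock_eqI, simp add: fock_coeff_simps)+

lemma bounded_clinear_fock_snd: "bounded_clinear fock_snd"
proof (rule bounded_clinearI)
  fix p :: "('d, 'f::complex_hilbert \<times> 'g::complex_hilbert) fock"
  show "norm (fock_snd p) \<le> norm p"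
    by (rule power2_le_imp_le) (simp_all add: norm_fock_decompose)
qed (rule fock_eqI, simp add: fock_coeff_simps)+

lemma norm_right_shift: "norm (right_shift k f) = norm f"
proof -
  have "(\<Sum>\<^sub>\<infinity>w. (norm (coeff (right_shift k f) w))\<^sup>2)
      = (\<Sum>\<^sub>\<infinity>w\<in>range (\<lambda>v. v @ [k]). (norm (coeff (right_shift k f) w))\<^sup>2)"
    by (rule infsum_cong_neutral)
      (auto simp: coeff_right_shift image_iff, metis append_butlast_last_id)
  also have "\<dots> = (\<Sum>\<^sub>\<infinity>v. (norm (coeff f v))\<^sup>2)"
    by (subst infsum_reindex) (auto simp: inj_on_def o_def coeff_right_shift)
  finally show ?thesis
    by (simp add: norm_fock_def)
qed

lemma isometry_right_shift: "isometry (right_shift k)"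
  by (rule isometryI; (rule norm_right_shift | rule fock_eqI); simp add: fock_coeff_simps)

lemma bounded_clinear_right_shift: "bounded_clinear (right_shift k)"
  by (rule conjunct1[OF isometry_right_shift[unfolded isometry_def]])

lemma row_isometry_right_shift: "row_isometry right_shift"
  unfolding row_isometry_def
proof (intro conjI allI impI isometry_right_shift)
  fix i j :: 'a and x y :: "('a, 'b) fock" assume "i \<noteq> j"
  then show "cinner (right_shift i x) (right_shift j y) = 0"
    unfolding cinner_fock_def by (intro infsum_0) (auto simp: coeff_right_shift)
qed

section \<open>Words in the shifts and in row isometries\<close>

lemma word_op_simps [simp]: "word_op X [] x = x" "word_op X (a # w) x = X a (word_op X w x)"
  by (simp_all add: word_op_def)

lemma fock_fst_word_op: "fock_fst (word_op right_shift w p) = word_op right_shift w (fock_fst p)"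
  and fock_snd_word_op: "fock_snd (word_op right_shift w p) = word_op right_shift w (fock_snd p)"
  by (induction w) (simp_all add: fock_fst_right_shift fock_snd_right_shift)

lemma word_op_right_shift_minus: "word_op right_shift w (- f) = - word_op right_shift w f"
  by (induction w) (auto intro!: fock_eqI simp: fock_coeff_simps)

lemma left_multiplier_word_op:
  "left_multiplier F \<Longrightarrow> F (word_op right_shift w x) = word_op right_shift w (F x)"
  by (induction w) (simp_all add: left_multiplier_def)

text \<open>Cancelling the common prefix of the two words reduces every inner product to one in which
  one of the words is empty.\<close>

lemma row_isometry_gram_eq:
  assumes V: "row_isometry V" and R: "row_isometry R"
    and one: "\<And>w m n. m \<in> M \<Longrightarrow> n \<in> M \<Longrightarrow>
      cinner (i m) (word_op V w (i n)) = cinner (j m) (word_op R w (j n))"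
    and "m \<in> M" "n \<in> M"
  shows "cinner (word_op V v (i m)) (word_op V w (i n)) = cinner (word_op R v (j m)) (word_op R w (j n))"
proof (induction v arbitrary: w)
  case Nil
  then show ?case using assms by simp
next
  case (Cons a v)
  show ?case
  proof (cases w)
    case Nil
    \<comment> \<open>The hypothesis \<open>one\<close> allows a word only in the second argument,
      so it is applied with \<open>m\<close> and \<open>n\<close> exchanged and then
      conjugated.\<close>
    then show ?thesis
      using one[OF \<open>n \<in> M\<close> \<open>m \<in> M\<close>, of "a # v"] by (metis cinner_commute word_op_simps(1))
  next
    case w: (Cons b u)
    show ?thesis
    proof (cases "a = b")
      case True
      then show ?thesis
        using V R Cons.IH[of u] by (simp add: w row_isometry_def isometry_cinner)
    next
      case False
      then show ?thesis
        using V R by (simp add: w row_isometry_def)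
    qed
  qed
qed

section \<open>Operator range spaces\<close>

text \<open>The preimage of least norm, that is, the inverse of \<open>T\<close> restricted to the
  orthogonal complement of its kernel. It is meaningful only on \<open>range T\<close>.\<close>

definition lift :: "('a::complex_hilbert \<Rightarrow> 'b::complex_hilbert) \<Rightarrow> 'b \<Rightarrow> 'a" where
  "lift T h = (THE x. x \<in> orth_compl (ker T) \<and> T x = h)"

lemma lift_eqI:
  assumes T: "bounded_clinear T" and x: "x \<in> orth_compl (ker T)" "T x = h"
  shows "lift T h = x"
  unfolding lift_def
proof (rule the_equality)
  fix z assume z: "z \<in> orth_compl (ker T) \<and> T z = h"
  then have "z - x \<in> orth_compl (ker T)" "z - x \<in> ker T"
    using x complex_vector.subspace_diff[OF orth_compl_subspace, of z "ker T" x]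
    by (simp_all add: ker_def bounded_clinearD[OF T])
  then have "cinner (z - x) (z - x) = 0"
    by (auto simp: orth_compl_def)
  then show "z = x"
    using cinner_eq_0_self[of "z - x"] by simp
qed (use x in blast)

text \<open>Subtracting from an arbitrary preimage its projection onto the closed kernel keeps the
  image and lands in the complement.\<close>

lemma lift:
  assumes T: "bounded_clinear T" and h: "h \<in> range T"
  shows "lift T h \<in> orth_compl (ker T)" "T (lift T h) = h"
proof -
  obtain x where x: "h = T x"
    using h by blast
  define z where "z = x - orth_proj (ker T) x"
  have "z \<in> orth_compl (ker T)" "T z = h"
    using orth_proj[OF ker_subspace closed_ker, OF T T, of x]
    by (simp_all add: z_def x bounded_clinearD[OF T] ker_def)
  then show "lift T h \<in> orth_compl (ker T)" "T (lift T h) = h"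
    using lift_eqI[OF T] by auto
qed

lemma lift_add:
  assumes T: "bounded_clinear T" and h: "h \<in> range T" "h' \<in> range T"
  shows "lift T (h + h') = lift T h + lift T h'"
  using lift[OF T h(1)] lift[OF T h(2)]
  by (intro lift_eqI[OF T]) (simp_all add: bounded_clinearD[OF T] complex_vector.subspace_add[OF orth_compl_subspace])

lemma lift_scaleC:
  assumes T: "bounded_clinear T" and h: "h \<in> range T"
  shows "lift T (c *\<^sub>C h) = c *\<^sub>C lift T h"
  using lift[OF T h]
  by (intro lift_eqI[OF T]) (simp_all add: bounded_clinearD[OF T] complex_vector.subspace_scale[OF orth_compl_subspace])

text \<open>Preimages of \<open>h\<close> differ by elements of the kernel, so all of them have the
  same projection onto its complement, namely \<open>lift T h\<close>. Hence the description
  defining the range norm has exactly one solution.\<close>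

lemma range_norm_eq:
  assumes T: "bounded_clinear T" and h: "h \<in> range T"
  shows "range_norm T h = norm (lift T h)"
proof -
  have "orth_proj (orth_compl (ker T)) x = lift T h" if "T x = h" for x
  proof (rule orth_proj_eqI[OF orth_compl_subspace])
    have "x - lift T h \<in> ker T"
      using lift[OF T h] that by (simp add: ker_def bounded_clinearD[OF T])
    then show "x - lift T h \<in> orth_compl (orth_compl (ker T))"
      by (auto simp: orth_compl_def) (metis cinner_commute complex_cnj_zero)
  qed (rule lift[OF T h])
  then show ?thesis
    unfolding range_norm_def using h by (intro the_equality) auto
qed

section \<open>The isometric copy of the meet space inside the kernel of the row\<close>

text \<open>The sign places the pair in the kernel of the row, and later produces the entry
  \<open>-H\<close> of the column.\<close>

definition meet_lift ::
  "(('d, 'f::complex_hilbert) fock \<Rightarrow> ('d, 'j::complex_hilbert) fock) \<Rightarrow>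
   (('d, 'g::complex_hilbert) fock \<Rightarrow> ('d, 'j) fock) \<Rightarrow> ('d, 'j) fock \<Rightarrow> ('d, 'f \<times> 'g) fock" where
  "meet_lift F G h = fock_pair (lift F h) (- lift G h)"

context
  fixes F :: "('d, 'f::complex_hilbert) fock \<Rightarrow> ('d, 'j::complex_hilbert) fock"
    and G :: "('d, 'g::complex_hilbert) fock \<Rightarrow> ('d, 'j) fock"
    and M :: "('d, 'j) fock normed_subspace"
  assumes F: "left_multiplier F" and G: "left_multiplier G"
  defines "M \<equiv> meet_space (range_space F) (range_space G)"
begin

lemma bcF: "bounded_clinear F" and bcG: "bounded_clinear G"
  using F G by (auto simp: left_multiplier_def)

lemma fst_M: "fst M = range F \<inter> range G"
  by (simp add: M_def meet_space_def range_space_def)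

lemma subspace_M: "complex_vector.subspace (fst M)"
  unfolding fst_M
proof (rule complex_vector.subspaceI)
  show "0 \<in> range F \<inter> range G"
    by (metis IntI bounded_clinearD(4) bcF bcG rangeI)
  show "x + y \<in> range F \<inter> range G" if "x \<in> range F \<inter> range G" "y \<in> range F \<inter> range G" for x y
    using that by (metis (no_types, lifting) IntE IntI bounded_clinearD(1) bcF bcG rangeE rangeI)
  show "c *\<^sub>C x \<in> range F \<inter> range G" if "x \<in> range F \<inter> range G" for c x
    using that by (metis (no_types, lifting) IntE IntI bounded_clinearD(5) bcF bcG rangeE rangeI)
qed

text \<open>The intertwining relation moves the shifts to the preimages under \<open>F\<close> and
  \<open>G\<close>. This invariance is what makes the restriction of the shifts to the meet space an
  operator tuple on it.\<close>

lemma word_op_M: "h \<in> fst M \<Longrightarrow> word_op right_shift w h \<in> fst M"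
proof -
  assume "h \<in> fst M"
  then obtain x y where "h = F x" "h = G y"
    unfolding fst_M by blast
  then have "word_op right_shift w h = F (word_op right_shift w x)"
    "word_op right_shift w h = G (word_op right_shift w y)"
    by (simp_all add: left_multiplier_word_op[OF F] left_multiplier_word_op[OF G])
  then show ?thesis
    unfolding fst_M by blast
qed

lemma meet_lift_add:
  "h \<in> fst M \<Longrightarrow> h' \<in> fst M \<Longrightarrow> meet_lift F G (h + h') = meet_lift F G h + meet_lift F G h'"
  by (simp add: fst_M meet_lift_def lift_add bcF bcG fock_pair_add[symmetric])

lemma meet_lift_scaleC:
  "h \<in> fst M \<Longrightarrow> meet_lift F G (c *\<^sub>C h) = c *\<^sub>C meet_lift F G h"
  by (simp add: fst_M meet_lift_def lift_scaleC bcF bcG fock_pair_scaleC[symmetric])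

lemma norm_meet_lift: "h \<in> fst M \<Longrightarrow> norm (meet_lift F G h) = snd M h"
proof -
  assume "h \<in> fst M"
  then have "(norm (meet_lift F G h))\<^sup>2 = (range_norm F h)\<^sup>2 + (range_norm G h)\<^sup>2"
    by (simp add: fst_M norm_fock_decompose range_norm_eq bcF bcG meet_lift_def)
  then show ?thesis
    by (simp add: M_def meet_space_def range_space_def real_sqrt_unique)
qed

section \<open>Isometric embeddings of the meet space\<close>

lemma isometric_embedding_meet_lift: "isometric_embedding M (meet_lift F G)"
  by (simp add: isometric_embedding_def meet_lift_add meet_lift_scaleC norm_meet_lift)

text \<open>By polarisation the norm of \<open>M\<close> alone fixes the inner products of embedded
  vectors, so the abstract embedding can be replaced by the concrete
  \<open>meet_lift F G\<close>.\<close>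

lemma cinner_isometric_embedding:
  assumes "isometric_embedding M i" "m \<in> fst M" "n \<in> fst M"
  shows "cinner (i m) (i n) = cinner (meet_lift F G m) (meet_lift F G n)"
proof -
  have "\<i> *\<^sub>C n \<in> fst M" "m + n \<in> fst M" "m + \<i> *\<^sub>C n \<in> fst M"
    using assms complex_vector.subspace_scale[OF subspace_M] complex_vector.subspace_add[OF subspace_M]
    by blast+
  then show ?thesis
    using assms isometric_embedding_meet_lift unfolding isometric_embedding_def
    by (intro cinner_eq_of_norm_eq) metis+
qed

lemma isometric_embedding_diff:
  assumes "isometric_embedding M i" "m \<in> fst M" "n \<in> fst M"
  shows "i (m - n) = i m - i n"
proof -
  have "(- 1) *\<^sub>C n \<in> fst M"
    using assms complex_vector.subspace_scale[OF subspace_M] by blast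
  then have "i (m + (- 1) *\<^sub>C n) = i m + (- 1) *\<^sub>C i n"
    using assms unfolding isometric_embedding_def by metis
  then show ?thesis
    by (simp add: scaleC_minus_one)
qed

text \<open>Distances can be computed in the concrete copy, so Cauchy sequences and limits may be
  transferred between the two embeddings.\<close>

lemma norm_isometric_embedding_diff:
  assumes i: "isometric_embedding M i" and mn: "m \<in> fst M" "n \<in> fst M"
  shows "norm (i m - i n) = norm (meet_lift F G m - meet_lift F G n)"
proof -
  have "m - n \<in> fst M"
    using mn complex_vector.subspace_diff[OF subspace_M] by blast
  then have "norm (i (m - n)) = norm (meet_lift F G (m - n))"
    using i isometric_embedding_meet_lift by (simp add: isometric_embedding_def)
  then show ?thesis
    using isometric_embedding_diff[OF i mn]
      isometric_embedding_diff[OF isometric_embedding_meet_lift mn] by simp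
qed

lemma F_meet_lift: "h \<in> fst M \<Longrightarrow> F (fock_fst (meet_lift F G h)) = h"
  and G_meet_lift: "h \<in> fst M \<Longrightarrow> G (fock_snd (meet_lift F G h)) = - h"
  by (simp_all add: meet_lift_def fst_M lift bcF bcG bounded_clinearD(3)[OF bcG])

text \<open>Equal images have equal \<open>meet_lift\<close>, and \<open>F\<close> recovers the
  element from its first component.\<close>

lemma inj_on_isometric_embedding:
  assumes i: "isometric_embedding M i"
  shows "inj_on i (fst M)"
proof (rule inj_onI)
  fix m n assume mn: "m \<in> fst M" "n \<in> fst M" "i m = i n"
  then have "meet_lift F G m = meet_lift F G n"
    using norm_isometric_embedding_diff[OF i mn(1,2)] by simp
  then show "m = n"
    using F_meet_lift mn by metis
qed

lemma subspace_isometric_image: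
  assumes i: "isometric_embedding M i"
  shows "complex_vector.subspace (i ` fst M)"
proof (rule complex_vector.subspaceI)
  note subs = complex_vector.subspace_0[OF subspace_M] complex_vector.subspace_add[OF subspace_M]
    complex_vector.subspace_scale[OF subspace_M]
  have "i 0 = 0"
    using isometric_embedding_diff[OF i subs(1) subs(1)] by simp
  then show "0 \<in> i ` fst M"
    using subs(1) by force
  show "x + y \<in> i ` fst M" if xy: "x \<in> i ` fst M" "y \<in> i ` fst M" for x y
  proof -
    obtain m n where "m \<in> fst M" "n \<in> fst M" "x = i m" "y = i n"
      using xy by blast
    moreover from this have "i (m + n) = i m + i n"
      using i by (simp add: isometric_embedding_def)
    ultimately show ?thesis
      using subs(2) by (metis imageI)
  qed
  show "c *\<^sub>C x \<in> i ` fst M" if x: "x \<in> i ` fst M" for c x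
  proof -
    obtain m where "m \<in> fst M" "x = i m"
      using x by blast
    moreover from this have "i (c *\<^sub>C m) = c *\<^sub>C i m"
      using i by (simp add: isometric_embedding_def)
    ultimately show ?thesis
      using subs(3) by (metis imageI)
  qed
qed

text \<open>This is the completeness of \<open>M\<close> in its own norm. A convergent sequence in
  the image is transferred to the concrete copy, where its limit is again a \<open>meet_lift\<close>
  because \<open>F\<close> and \<open>G\<close> are continuous and orthogonal complements are
  closed. Closedness makes \<open>orth_proj\<close> onto the image a genuine projection.\<close>

lemma closed_isometric_image:
  assumes i: "isometric_embedding M i"
  shows "closed (i ` fst M)"
  unfolding closed_sequential_limits
proof (intro allI impI)
  fix y l assume "(\<forall>n. y n \<in> i ` fst M) \<and> y \<longlonglongrightarrow> l"
  then have y: "\<And>n. y n \<in> i ` fst M" "y \<longlonglongrightarrow> l"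
    by auto
  then have "\<forall>n. \<exists>m. m \<in> fst M \<and> y n = i m"
    by blast
  then obtain m where m: "\<And>n. m n \<in> fst M" and ym: "\<And>n. y n = i (m n)"
    by metis
  define p where "p n = meet_lift F G (m n)" for n
  have "Cauchy y"
    using y(2) by (rule LIMSEQ_imp_Cauchy)
  then have "Cauchy p"
    unfolding Cauchy_def dist_norm p_def ym by (simp add: norm_isometric_embedding_diff[OF i] m)
  then obtain q where q: "p \<longlonglongrightarrow> q"
    by (auto simp: Cauchy_convergent_iff convergent_def)
  define f where "f = fock_fst q"
  define g where "g = - fock_snd q"
  have f: "(\<lambda>n. lift F (m n)) \<longlonglongrightarrow> f"
    using tendsto_bounded_clinear[OF bounded_clinear_fock_fst q] by (simp add: f_def p_def meet_lift_def)
  have g: "(\<lambda>n. lift G (m n)) \<longlonglongrightarrow> g"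
    using tendsto_minus[OF tendsto_bounded_clinear[OF bounded_clinear_fock_snd q]]
    by (simp add: g_def p_def meet_lift_def)
  \<comment> \<open>Here \<open>m\<close> converges in the ambient Fock space, not yet in the norm
    of \<open>M\<close>. Uniqueness of that limit shows that \<open>f\<close> and \<open>g\<close>
    have the same image, which therefore lies in \<open>M\<close>.\<close>
  have Ff: "m \<longlonglongrightarrow> F f" and Gg: "m \<longlonglongrightarrow> G g"
    using tendsto_bounded_clinear[OF bcF f] tendsto_bounded_clinear[OF bcG g] m
    by (simp_all add: lift bcF bcG fst_M)
  then have FG: "F f = G g"
    using LIMSEQ_unique by blast
  have oF: "f \<in> orth_compl (ker F)" and oG: "g \<in> orth_compl (ker G)"
    using m by (auto simp: fst_M intro!: closed_sequentially[OF closed_orth_compl _ f]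
        closed_sequentially[OF closed_orth_compl _ g] lift bcF bcG)
  have "F f \<in> fst M"
    by (metis FG IntI fst_M rangeI)
  moreover have "fock_pair f (- g) = q"
    by (rule fock_eqI) (simp add: f_def g_def fock_coeff_simps)
  then have "meet_lift F G (F f) = q"
    using lift_eqI[OF bcF oF refl] lift_eqI[OF bcG oG refl] by (simp add: meet_lift_def FG)
  ultimately have "norm (y n - i (F f)) = norm (p n - q)" for n
    using norm_isometric_embedding_diff[OF i m] by (simp add: ym p_def)
  then have "y \<longlonglongrightarrow> i (F f)"
    using q unfolding LIMSEQ_iff by simp
  then have "l = i (F f)"
    using y(2) LIMSEQ_unique by blast
  then show "l \<in> i ` fst M"
    using \<open>F f \<in> fst M\<close> by blast
qed

text \<open>Shifting \<open>meet_lift F G h\<close> changes it, modulo the orthogonal complement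
  \<open>ker F \<oplus> ker G\<close> of the copy, into the lift of the shifted \<open>h\<close>; so the shift dilates its
  restriction to the meet space.\<close>

lemma cinner_meet_lift_word_op:
  assumes "m \<in> fst M" "n \<in> fst M"
  shows "cinner (meet_lift F G m) (word_op right_shift w (meet_lift F G n))
    = cinner (meet_lift F G m) (meet_lift F G (word_op right_shift w n))"
proof -
  define r where "r = word_op right_shift w (meet_lift F G n) - meet_lift F G (word_op right_shift w n)"
  have "F (fock_fst r) = 0"
    using assms word_op_M
    by (simp add: r_def fock_fst_diff fock_fst_word_op bounded_clinearD(2)[OF bcF]
        left_multiplier_word_op[OF F] F_meet_lift)
  moreover have "lift F m \<in> orth_compl (ker F)"
    using assms by (simp add: fst_M lift bcF)
  ultimately have 1: "cinner (fock_fst r) (lift F m) = 0"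
    by (simp add: orth_compl_def ker_def)
  have "G (fock_snd r) = 0"
    using assms word_op_M
    by (simp add: r_def fock_snd_diff fock_snd_word_op word_op_right_shift_minus bounded_clinearD(2)[OF bcG]
        left_multiplier_word_op[OF G] G_meet_lift)
  moreover have "lift G m \<in> orth_compl (ker G)"
    using assms by (simp add: fst_M lift bcG)
  ultimately have 2: "cinner (fock_snd r) (lift G m) = 0"
    by (simp add: orth_compl_def ker_def)
  have "cinner r (meet_lift F G m) = 0"
    using 1 2 by (simp add: cinner_fock_decompose[of r] meet_lift_def cinner_minus_right)
  then have "cinner (meet_lift F G m) r = 0"
    by (metis cinner_commute complex_cnj_zero)
  then show ?thesis
    by (simp add: r_def cinner_diff_right)
qed

text \<open>Against a vector of the embedded copy, \<open>word_op V w (i n)\<close> may be replaced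
  by its projection, which the dilation property identifies. What remains depends only on
  \<open>M\<close>, and the shifts give the same value on the concrete copy.\<close>

lemma cinner_dilation:
  assumes dil: "row_isometric_dilation M right_shift i V" and mn: "m \<in> fst M" "n \<in> fst M"
  shows "cinner (i m) (word_op V w (i n)) = cinner (meet_lift F G m) (word_op right_shift w (meet_lift F G n))"
proof -
  have i: "isometric_embedding M i"
    and pr: "orth_proj (i ` fst M) (word_op V w (i n)) = i (word_op right_shift w n)"
    using dil mn by (auto simp: row_isometric_dilation_def)
  have "cinner (i m) (word_op V w (i n) - i (word_op right_shift w n)) = 0"
    using orth_proj(2)[OF subspace_isometric_image[OF i] closed_isometric_image[OF i],
        of "word_op V w (i n)"] mn
    unfolding pr orth_compl_def by blast
  then have "cinner (i m) (word_op V w (i n)) = cinner (i m) (i (word_op right_shift w n))"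
    by (simp add: cinner_diff_right)
  also have "\<dots> = cinner (meet_lift F G m) (meet_lift F G (word_op right_shift w n))"
    using i mn word_op_M by (intro cinner_isometric_embedding)
  finally show ?thesis
    using cinner_meet_lift_word_op[OF mn] by simp
qed

text \<open>The vectors indexed by pairs of a word and an element of \<open>M\<close> have the same
  Gram matrix in both dilations, and on the side of \<open>V\<close> they are total by minimality.
  \<open>W\<close> is only an isometry, because the concrete copy need not generate the kernel of
  the row under the shifts.\<close>

lemma dilation_isometry_exists:
  assumes min: "minimal_row_isometric_dilation M right_shift i V"
  shows "\<exists>W. isometry W \<and>
    (\<forall>w. \<forall>m\<in>fst M. W (word_op V w (i m)) = word_op right_shift w (meet_lift F G m))"
proof -
  have dil: "row_isometric_dilation M right_shift i V"
    and dense: "closure (complex_vector.span (\<Union>w. word_op V w ` i ` fst M)) = UNIV"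
    using min by (auto simp: minimal_row_isometric_dilation_def)
  define A where "A = (\<lambda>(w, m). word_op V w (i m))"
  define B where "B = (\<lambda>(w, m). word_op right_shift w (meet_lift F G m))"
  have "(\<Union>w. word_op V w ` i ` fst M) = A ` (UNIV \<times> fst M)"
    by (auto simp: A_def)
  moreover have "cinner (A p) (A q) = cinner (B p) (B q)"
    if "p \<in> UNIV \<times> fst M" "q \<in> UNIV \<times> fst M" for p q
  proof -
    have "row_isometry V"
      using dil by (simp add: row_isometric_dilation_def)
    then show ?thesis
      using row_isometry_gram_eq[OF _ row_isometry_right_shift cinner_dilation[OF dil]] that
      unfolding A_def B_def by (auto simp: split_beta)
  qed
  ultimately have "\<exists>W. isometry W \<and> (\<forall>p\<in>UNIV \<times> fst M. W (A p) = B p)"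
    using dense by (intro isometry_of_gram_eq) auto
  then show ?thesis
    by (auto simp: A_def B_def)
qed

end

section \<open>Transport by the unitary and assembly of the inner multiplier\<close>

lemma isometry_inv_unitary:
  assumes "unitary U"
  shows "isometry (inv U)" "U (inv U y) = y" "inv U (U x) = x"
proof -
  have bc: "bounded_clinear U" and nU: "\<And>x. norm (U x) = norm x" and "surj U"
    using assms by (auto simp: unitary_def isometry_def)
  have "inj U"
  proof (rule injI)
    fix x y assume "U x = U y"
    then have "norm (U (x - y)) = 0"
      by (simp add: bounded_clinearD(2)[OF bc])
    then show "x = y"
      using nU by simp
  qed
  then show invl: "inv U (U x) = x" for x
    by simp
  show invr: "U (inv U y) = y" for y
    using \<open>surj U\<close> by (simp add: surj_f_inv_f)
  show "isometry (inv U)"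
  proof (rule isometryI)
    show "inv U (x + y) = inv U x + inv U y" for x y
      by (metis bounded_clinearD(1)[OF bc] invl invr)
    show "inv U (c *\<^sub>C x) = c *\<^sub>C inv U x" for c x
      by (metis bounded_clinearD(5)[OF bc] invl invr)
    show "norm (inv U x) = norm x" for x
      by (metis nU invr)
  qed
qed

theorem theorem6p7:
  fixes F :: "('d::finite, 'f::complex_hilbert) fock \<Rightarrow> ('d, 'j::complex_hilbert) fock"
    and G :: "('d, 'g::complex_hilbert) fock \<Rightarrow> ('d, 'j) fock"
    and H :: "('d, 'h::complex_hilbert) fock \<Rightarrow> ('d, 'j) fock"
    and \<iota> :: "('d, 'j) fock \<Rightarrow> 'k::complex_hilbert"
    and V :: "'d \<Rightarrow> 'k \<Rightarrow> 'k"
    and U :: "('d, 'h) fock \<Rightarrow> 'k"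
  assumes "left_multiplier F" and "left_multiplier G"
    and "left_multiplier H" and "is_wedge F G \<iota> V U H"
  shows "\<exists>\<Gamma> :: ('d, 'h) fock \<Rightarrow> ('d, 'f \<times> 'g) fock.
           left_inner \<Gamma> \<and> range \<Gamma> \<subseteq> ker (F \<or>\<^sub>L G) \<and>
           column_op H (- H) = diag_op F G \<circ> \<Gamma>"
proof -
  note FG = assms(1,2)
  define M where "M = meet_space (range_space F) (range_space G)"
  let ?J = "meet_lift F G"
  let ?A = "\<Union>w. word_op V w ` \<iota> ` fst M"
  have min: "minimal_row_isometric_dilation M right_shift \<iota> V" and U: "unitary U"
    and UV: "\<And>k x. U (right_shift k x) = V k (U x)"
    and H: "\<And>x. H x = inv_into (fst M) \<iota> (orth_proj (\<iota> ` fst M) (U x))"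
    using assms(4) by (auto simp: is_wedge_def de_Branges_Beurling_def M_def)
  have dense: "closure (complex_vector.span ?A) = UNIV"
    and dil: "row_isometric_dilation M right_shift \<iota> V"
    using min by (auto simp: minimal_row_isometric_dilation_def)
  have emb: "isometric_embedding M \<iota>" and V: "\<And>k. bounded_clinear (V k)"
    using dil by (auto simp: row_isometric_dilation_def row_isometry_def isometry_def)
  have bc: "bounded_clinear F" "bounded_clinear G" "bounded_clinear H" "bounded_clinear U"
    using assms U by (auto simp: left_multiplier_def unitary_def isometry_def)
  obtain W :: "'k \<Rightarrow> ('d, 'f \<times> 'g) fock" where W: "isometry W"
    and W_word: "\<And>w m. m \<in> fst M \<Longrightarrow> W (word_op V w (\<iota> m)) = word_op right_shift w (?J m)"
    using dilation_isometry_exists[OF FG, folded M_def, OF min] by blast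
  have bcW: "bounded_clinear W"
    using W by (simp add: isometry_def)
  \<comment> \<open>On a generator both sides amount to prepending the letter \<open>k\<close> to
    the word.\<close>
  have W_shift: "W (V k y) = right_shift k (W y)" for k y
  proof (rule bounded_clinear_eq_on_dense[where S = "\<lambda>y. W (V k y)" and T = "\<lambda>y. right_shift k (W y)", OF _ _ _ dense])
    show "bounded_clinear (\<lambda>y. W (V k y))"
      by (rule bounded_clinear_compose[OF bcW V])
    show "bounded_clinear (\<lambda>y. right_shift k (W y))"
      by (rule bounded_clinear_compose[OF bounded_clinear_right_shift bcW])
    show "W (V k x) = right_shift k (W x)" if x: "x \<in> ?A" for x
    proof -
      obtain w m where "m \<in> fst M" "x = word_op V w (\<iota> m)"
        using x by blast
      then show ?thesis
        using W_word[of m "k # w"] W_word[of m w] by simp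
    qed
  qed
  \<comment> \<open>The first row of the factorisation, transported to the dilation space by the
    inverse of \<open>U\<close> so that it can be tested on the total set of words.\<close>
  have FW: "H (inv U y) = F (fock_fst (W y))" for y
  proof (rule bounded_clinear_eq_on_dense[where S = "\<lambda>y. H (inv U y)" and T = "\<lambda>y. F (fock_fst (W y))", OF _ _ _ dense])
    show "bounded_clinear (\<lambda>y. H (inv U y))"
      using isometry_inv_unitary(1)[OF U]
      by (intro bounded_clinear_compose[OF bc(3)]) (simp add: isometry_def)
    show "bounded_clinear (\<lambda>y. F (fock_fst (W y)))"
      by (rule bounded_clinear_compose[OF bc(1) bounded_clinear_compose[OF bounded_clinear_fock_fst bcW]])
    show "H (inv U x) = F (fock_fst (W x))" if x: "x \<in> ?A" for x
    proof -
      obtain w m where m: "m \<in> fst M" and x: "x = word_op V w (\<iota> m)"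
        using x by blast
      \<comment> \<open>The dilation property evaluates the projection inside \<open>H\<close>, and
        injectivity of \<open>\<iota>\<close> on \<open>M\<close> undoes the embedding.\<close>
      have "H (inv U x) = inv_into (fst M) \<iota> (\<iota> (word_op right_shift w m))"
        using dil m by (simp add: H isometry_inv_unitary(2)[OF U] x row_isometric_dilation_def)
      also have "\<dots> = word_op right_shift w m"
        using inj_on_isometric_embedding[OF FG, folded M_def, OF emb]
          word_op_M[OF FG, folded M_def, OF m] by (rule inv_into_f_f)
      also have "\<dots> = F (fock_fst (W x))"
        using F_meet_lift[OF FG, folded M_def, OF m]
        by (simp add: x W_word m fock_fst_word_op left_multiplier_word_op FG)
      finally show ?thesis .
    qed
  qed
  \<comment> \<open>On a generator the two terms are the shifted \<open>m\<close> and its negative.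
    The identity gives both the inclusion in the kernel of the row and, combined with the first row,
    the second row of the factorisation.\<close>
  have GW: "F (fock_fst (W y)) + G (fock_snd (W y)) = 0" for y
  proof (rule bounded_clinear_eq_on_dense[where S = "\<lambda>y. F (fock_fst (W y)) + G (fock_snd (W y))" and T = "\<lambda>_. 0", OF _ bounded_clinear_zero _ dense])
    show "bounded_clinear (\<lambda>y. F (fock_fst (W y)) + G (fock_snd (W y)))"
      by (rule bounded_clinear_add[OF
            bounded_clinear_compose[OF bc(1) bounded_clinear_compose[OF bounded_clinear_fock_fst bcW]]
            bounded_clinear_compose[OF bc(2) bounded_clinear_compose[OF bounded_clinear_fock_snd bcW]]])
    show "F (fock_fst (W x)) + G (fock_snd (W x)) = 0" if x: "x \<in> ?A" for x
    proof -
      obtain w m where m: "m \<in> fst M" and x: "x = word_op V w (\<iota> m)"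
        using x by blast
      show ?thesis
        using F_meet_lift[OF FG, folded M_def, OF m] G_meet_lift[OF FG, folded M_def, OF m]
        by (simp add: x W_word m fock_fst_word_op fock_snd_word_op word_op_right_shift_minus
            left_multiplier_word_op FG)
    qed
  qed
  define \<Gamma> where "\<Gamma> x = W (U x)" for x
  have "isometry \<Gamma>"
    using W U bounded_clinear_compose[OF bcW bc(4)]
    unfolding \<Gamma>_def isometry_def unitary_def by auto
  moreover have "\<Gamma> (right_shift k x) = right_shift k (\<Gamma> x)" for k x
    by (simp add: \<Gamma>_def UV W_shift)
  ultimately have "left_inner \<Gamma>"
    by (simp add: left_inner_def left_multiplier_def isometry_def)
  moreover have "range \<Gamma> \<subseteq> ker (F \<or>\<^sub>L G)"
    using GW by (auto simp: ker_def row_op_def \<Gamma>_def)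
  moreover have "column_op H (- H) x = (diag_op F G \<circ> \<Gamma>) x" for x
  proof -
    have "H x = F (fock_fst (\<Gamma> x))"
      using FW[of "U x"] by (simp add: \<Gamma>_def isometry_inv_unitary(3)[OF U])
    moreover have "- F (fock_fst (\<Gamma> x)) = G (fock_snd (\<Gamma> x))"
      using GW[of "U x"] by (simp add: \<Gamma>_def minus_unique)
    ultimately show ?thesis
      by (simp add: column_op_def diag_op_def)
  qed
  ultimately show ?thesis
    by blast
qed

end
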